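(* Let $G$ be a countably infinite discrete group and let $X$ be a Borel $G$-space that admits a $\sigma$-compact realization. If there is no $G$-invariant Borel probability measure on $X$, then $X$ admits a Borel $32$-generator.
   Context: A Borel $G$-space is a standard Borel space $X$ equipped with a Borel action of $G$. A $k$-generator for $X$ is a partition $\{A_n\}_{n<k}$ of $X$ into Borel sets (pieces may be empty) such that $\{gA_n : g\in G, n<k\}$ generates the Borel $\sigma$-algebra of $X$. $X$ admits a $\sigma$-compact realization if there is a Hausdorff second countable $\sigma$-compact topology on $X$ that makes the $G$-action continuous and whose Borel $\sigma$-algebra equals the given Borel $\sigma$-algebra of $X$. *)

theory Defs
  imports "HOL-Probability.Probability" "HOL-Algebra.Group_Action"
begin

definition borel_of :: "'a topology \<Rightarrow> 'a measure" where
  "borel_of T = sigma (topspace T) {U. openin T U}"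

definition polish_topology :: "'a topology \<Rightarrow> bool" where
  "polish_topology T \<longleftrightarrow> completely_metrizable_space T \<and> second_countable T"

text \<open>
  Measures are used here as measurable spaces: only \<open>space\<close> and \<open>sets\<close> matter. Equality of
  \<open>sets\<close> forces equality of \<open>space\<close>.
\<close>

definition standard_borel :: "'a measure \<Rightarrow> bool" where
  "standard_borel X \<longleftrightarrow> (\<exists>T. polish_topology T \<and> sets (borel_of T) = sets X)"

text \<open>
  Throughout, the group carries the discrete topology, hence the discrete Borel structure
  \<open>count_space (carrier G)\<close>, and \<open>\<phi> g x\<close> is the point \<open>g \<cdot> x\<close>.
\<close>

definition borel_G_space ::
  "('g, 'b) monoid_scheme \<Rightarrow> 'a measure \<Rightarrow> ('g \<Rightarrow> 'a \<Rightarrow> 'a) \<Rightarrow> bool" where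
  "borel_G_space G X \<phi> \<longleftrightarrow>
     standard_borel X \<and> group_action G (space X) \<phi> \<and>
     (\<lambda>(g, x). \<phi> g x) \<in> measurable (count_space (carrier G) \<Otimes>\<^sub>M X) X"

definition sigma_compact_space :: "'a topology \<Rightarrow> bool" where
  "sigma_compact_space T \<longleftrightarrow>
     (\<exists>K :: nat \<Rightarrow> 'a set. (\<forall>n. compactin T (K n)) \<and> (\<Union>n. K n) = topspace T)"

definition admits_sigma_compact_realization ::
  "('g, 'b) monoid_scheme \<Rightarrow> 'a measure \<Rightarrow> ('g \<Rightarrow> 'a \<Rightarrow> 'a) \<Rightarrow> bool" where
  "admits_sigma_compact_realization G X \<phi> \<longleftrightarrow>
     (\<exists>T. Hausdorff_space T \<and> second_countable T \<and> sigma_compact_space T \<and>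
          continuous_map (prod_topology (discrete_topology (carrier G)) T) T (\<lambda>(g, x). \<phi> g x) \<and>
          sets (borel_of T) = sets X)"

definition invariant_prob_measure ::
  "('g, 'b) monoid_scheme \<Rightarrow> 'a measure \<Rightarrow> ('g \<Rightarrow> 'a \<Rightarrow> 'a) \<Rightarrow> 'a measure \<Rightarrow> bool" where
  "invariant_prob_measure G X \<phi> \<mu> \<longleftrightarrow>
     sets \<mu> = sets X \<and> prob_space \<mu> \<and>
     (\<forall>g\<in>carrier G. \<forall>A\<in>sets X. emeasure \<mu> (\<phi> g ` A) = emeasure \<mu> A)"

definition generator ::
  "('g, 'b) monoid_scheme \<Rightarrow> 'a measure \<Rightarrow> ('g \<Rightarrow> 'a \<Rightarrow> 'a) \<Rightarrow> nat \<Rightarrow> (nat \<Rightarrow> 'a set) \<Rightarrow> bool" where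
  "generator G X \<phi> k A \<longleftrightarrow>
     (\<forall>n<k. A n \<in> sets X) \<and> disjoint_family_on A {..<k} \<and> (\<Union>n<k. A n) = space X \<and>
     sigma_sets (space X) {\<phi> g ` A n | g n. g \<in> carrier G \<and> n < k} = sets X"

end

theory Submission
  imports Defs "HOL-Algebra.Elementary_Groups"
begin

text \<open>
  No invariant probability measure forces, on every orbit, a contradiction that can be witnessed by two
  Borel sets \<open>A\<close>, \<open>B\<close> only. Compare \<open>q\<close> copies of \<open>A\<close> with \<open>p\<close> copies of the space by a greedy
  matching along an enumeration of the group, and let \<open>m(A)\<close> at a point be the infimum of the \<open>p/q\<close> for
  which all copies of \<open>A\<close> get matched on its orbit. If \<open>m\<close> were additive, invariant and positive on a
  compact set at a single point, for all sets from a countable family of open sets, it would induce an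
  invariant Borel probability measure. So at every point some instance of these properties fails for some
  \<open>A\<close>, \<open>B\<close>, and each such failure compresses finitely many copies of the space into fewer copies.

  The greedy matching only sees the itinerary of a point with respect to \<open>A\<close> and \<open>B\<close>, so the failures form
  a fixed invariant subset \<open>R\<close> of the shift space over pairs of bits, and countably many choices of
  \<open>A\<close>, \<open>B\<close> can be glued into one for which all itineraries lie in \<open>R\<close>. Iterating a compression
  attaches to the points of a complete section infinitely many places, disjoint for different points and
  computable from the itineraries. A third set stores there, bit by bit, which members of a countable
  family generating the Borel sets contain the point. The three sets generate, so 8 pieces suffice.
\<close>

section \<open>Countable group actions and greedy matching\<close>

text \<open>The set \<open>R\<close> has to be fixed before \<open>A\<close> and \<open>B\<close>
  are chosen, because gluing needs one target for all itineraries. An embedding given by mere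
  existence need not be readable from an itinerary; a fixed greedy rule commutes with equivariant
  maps, and it still decides comparability on each orbit. Every property required of
  \<open>m\<close> (subadditivity, superadditivity, invariance, boundedness, positivity) mentions at
  most two sets besides group elements. Hence two bits per itinerary entry and, with the storing
  set, 2^3 = 8 atoms. A compression concerns \<open>N\<close> copies of the space, and no
  cancellation law is invoked to pass to one copy: iteration puts infinitely many tokens per point
  into \<open>N\<close> slots, and a pigeonhole over the slots returns to the space itself.
  Positivity is the delicate property. A content on open sets may vanish near every compact set;
  sigma-compactness puts the given point into some compact \<open>K l\<close>, where a lower bound
  is needed. Its failure, arbitrarily many copies of \<open>K l\<close> fitting into the space, is
  not directly a compression and needs its own packing argument.\<close>

lemma disjoint_family_diff_decseq:
  assumes "\<And>k. A (Suc k) \<subseteq> A k"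
  shows "disjoint_family (\<lambda>k::nat. A k - A (Suc k))"
proof -
  have "decseq A" using assms by (simp add: decseq_Suc_iff)
  then have "A m \<subseteq> A (Suc n)" if "n < m" for n m using that by (auto simp: decseq_def Suc_le_eq)
  then have "(A n - A (Suc n)) \<inter> (A m - A (Suc m)) = {}" if "n < m" for n m using that by blast
  then show ?thesis unfolding disjoint_family_on_def by (metis Int_commute linorder_neqE_nat)
qed

lemma Diff_INT_decseq:
  fixes A :: "nat \<Rightarrow> 'c set"
  assumes "\<And>k. A (Suc k) \<subseteq> A k"
  shows "A 0 - (\<Inter>k. A k) = (\<Union>k. A k - A (Suc k))"
proof -
  have "decseq A" using assms by (simp add: decseq_Suc_iff)
  then have sub: "A k \<subseteq> A 0" for k by (auto simp: decseq_def)
  have "\<exists>k. x \<in> A k \<and> x \<notin> A (Suc k)" if "x \<in> A 0" "x \<notin> A n" for x n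
    using that by (induction n) auto
  then show ?thesis using sub by (intro Set.set_eqI iffI) (simp_all, blast+)
qed

text \<open>Stated for bare measurable spaces, so that one theory serves \<open>X\<close>, the shift
  space, the spaces of tokens, and the smaller sigma-algebras on \<open>space X\<close> that occur
  in decoding.\<close>

locale meas_action = group G for G (structure) +
  fixes M :: "'a measure" and \<phi> :: "'g \<Rightarrow> 'a \<Rightarrow> 'a"
  assumes countable_carrier: "countable (carrier G)"
    and act_meas [measurable]: "g \<in> carrier G \<Longrightarrow> \<phi> g \<in> measurable M M"
    and act_one [simp]: "x \<in> space M \<Longrightarrow> \<phi> \<one> x = x"
    and act_mult: "\<lbrakk>g \<in> carrier G; h \<in> carrier G; x \<in> space M\<rbrakk> \<Longrightarrow> \<phi> (g \<otimes> h) x = \<phi> g (\<phi> h x)"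
begin

lemma act_space [simp]: "\<lbrakk>g \<in> carrier G; x \<in> space M\<rbrakk> \<Longrightarrow> \<phi> g x \<in> space M"
  by (rule measurable_space[OF act_meas])

lemma act_inv [simp]:
  assumes "g \<in> carrier G" "x \<in> space M"
  shows "\<phi> (inv g) (\<phi> g x) = x" "\<phi> g (\<phi> (inv g) x) = x"
  using assms act_mult[of "inv g" g x] act_mult[of g "inv g" x] by auto

lemma act_inj: "\<lbrakk>g \<in> carrier G; x \<in> space M; y \<in> space M; \<phi> g x = \<phi> g y\<rbrakk> \<Longrightarrow> x = y"
  by (metis act_inv(1))

lemma act_image_eq:
  assumes "g \<in> carrier G" "A \<subseteq> space M"
  shows "\<phi> g ` A = {x \<in> space M. \<phi> (inv g) x \<in> A}"
proof (intro Set.set_eqI iffI)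
  fix x assume "x \<in> {x \<in> space M. \<phi> (inv g) x \<in> A}"
  then show "x \<in> \<phi> g ` A" using assms by (intro image_eqI[of _ _ "\<phi> (inv g) x"]) auto
qed (use assms in auto)

lemma act_vimage_sets [measurable]:
  assumes "g \<in> carrier G" "A \<in> sets M"
  shows "{x \<in> space M. \<phi> g x \<in> A} \<in> sets M"
  using measurable_sets[OF act_meas[OF assms(1)] assms(2)] by (simp add: vimage_def Int_def conj_commute)

lemma act_image_sets:
  assumes "g \<in> carrier G" "A \<in> sets M"
  shows "\<phi> g ` A \<in> sets M"
  using assms sets.sets_into_space[OF assms(2)] by (simp add: act_image_eq act_vimage_sets)

section \<open>Invariant sets and saturations\<close>

definition invariant :: "'a set \<Rightarrow> bool" where
  "invariant W \<longleftrightarrow> W \<in> sets M \<and> (\<forall>g\<in>carrier G. \<forall>x\<in>W. \<phi> g x \<in> W)"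

lemma invariant_sets [simp]: "invariant W \<Longrightarrow> W \<in> sets M"
  by (simp add: invariant_def)

lemma invariant_iff:
  "\<lbrakk>invariant W; g \<in> carrier G; x \<in> space M\<rbrakk> \<Longrightarrow> \<phi> g x \<in> W \<longleftrightarrow> x \<in> W"
  unfolding invariant_def by (metis act_inv(1) inv_closed)

lemma invariant_space [simp]: "invariant (space M)"
  by (simp add: invariant_def)

lemma invariant_countable_Union:
  "\<lbrakk>countable \<W>; \<And>W. W \<in> \<W> \<Longrightarrow> invariant W\<rbrakk> \<Longrightarrow> invariant (\<Union>\<W>)"
  unfolding invariant_def by (auto intro: sets.countable_Union)

lemma invariant_Int: "\<lbrakk>invariant V; invariant W\<rbrakk> \<Longrightarrow> invariant (V \<inter> W)"
  unfolding invariant_def by auto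

lemma invariant_INT: "(\<And>n::nat. invariant (W n)) \<Longrightarrow> invariant (\<Inter>n. W n)"
  unfolding invariant_def by auto

lemma invariant_Diff: "\<lbrakk>invariant V; invariant W\<rbrakk> \<Longrightarrow> invariant (V - W)"
  using sets.sets_into_space[of V M] invariant_iff[of W] unfolding invariant_def by blast

lemma invariant_disjointed: 
  assumes "\<And>n::nat. invariant (W n)" shows "invariant (disjointed W n)"
proof -
  have "invariant (\<Union>i\<in>{0..<k}. W i)" for k
    using assms unfolding invariant_def by auto
  then show ?thesis unfolding disjointed_def using assms invariant_Diff by blast
qed

definition saturation :: "'a set \<Rightarrow> 'a set" where
  "saturation A = {x \<in> space M. \<exists>g\<in>carrier G. \<phi> g x \<in> A}"

lemma saturation_sets [measurable]: "A \<in> sets M \<Longrightarrow> saturation A \<in> sets M"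
  unfolding saturation_def
  by (intro sets.sets_Collect_countable_Ex' countable_carrier act_vimage_sets)

lemma invariant_saturation:
  assumes "A \<in> sets M" shows "invariant (saturation A)"
proof -
  have "\<phi> g x \<in> saturation A" if g: "g \<in> carrier G" and x: "x \<in> saturation A" for g x
  proof -
    obtain h where h: "h \<in> carrier G" "\<phi> h x \<in> A" using x by (auto simp: saturation_def)
    have "\<phi> (h \<otimes> inv g) (\<phi> g x) = \<phi> h x"
      using g h x by (simp add: act_mult saturation_def)
    then show ?thesis using g h x unfolding saturation_def 
      by (auto intro!: bexI[of _ "h \<otimes> inv g"])
  qed
  then show ?thesis using assms by (auto simp: invariant_def)
qed

lemma subset_saturation: "A \<subseteq> space M \<Longrightarrow> A \<subseteq> saturation A"
  by (auto simp: saturation_def intro!: bexI[of _ \<one>])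

lemma invariant_avoiding:
  assumes "A \<in> sets M" shows "invariant {x \<in> space M. \<forall>g\<in>carrier G. \<phi> g x \<notin> A}"
proof -
  have "{x \<in> space M. \<forall>g\<in>carrier G. \<phi> g x \<notin> A} = space M - saturation A"
    by (auto simp: saturation_def)
  then show ?thesis using invariant_Diff[OF invariant_space invariant_saturation[OF assms]] by simp
qed

text \<open>An injection inside orbits, recorded by the group element \<open>\<gamma> x\<close>
  rather than by the image point: measurability then concerns countably many level sets, and the
  element can later be read off an itinerary.\<close>

definition embeds :: "('a \<Rightarrow> 'g) \<Rightarrow> 'a set \<Rightarrow> 'a set \<Rightarrow> bool" where
  "embeds \<gamma> E F \<longleftrightarrow> E \<in> sets M \<and> (\<forall>x\<in>E. \<gamma> x \<in> carrier G \<and> \<phi> (\<gamma> x) x \<in> F) \<and>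
     inj_on (\<lambda>x. \<phi> (\<gamma> x) x) E \<and> (\<forall>g\<in>carrier G. {x \<in> E. \<gamma> x = g} \<in> sets M)"

definition le :: "'a set \<Rightarrow> 'a set \<Rightarrow> bool" (infix "\<hookrightarrow>" 50) where
  "E \<hookrightarrow> F \<longleftrightarrow> (\<exists>\<gamma>. embeds \<gamma> E F)"

lemma le_act_image:
  assumes "E \<in> sets M" "g \<in> carrier G"
  shows "E \<hookrightarrow> \<phi> g ` E"
proof -
  have "inj_on (\<phi> g) E" using assms sets.sets_into_space[OF assms(1)]
    by (meson act_inj inj_onI subsetD)
  moreover have "{x \<in> E. g = h} \<in> sets M" for h using assms by (cases "g = h") auto
  ultimately have "embeds (\<lambda>_. g) E (\<phi> g ` E)"
    unfolding embeds_def using assms by auto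
  then show ?thesis by (auto simp: le_def)
qed

lemma act_inv_image:
  assumes "E \<subseteq> space M" "g \<in> carrier G"
  shows "\<phi> (inv g) ` \<phi> g ` E = E"
  using assms by (force simp: image_image)

lemma act_image_le:
  assumes "E \<in> sets M" "g \<in> carrier G"
  shows "\<phi> g ` E \<hookrightarrow> E"
  using le_act_image[OF act_image_sets[OF assms(2,1)], of "inv g"] assms
    act_inv_image[OF sets.sets_into_space[OF assms(1)]] by simp

lemma le_mono: "\<lbrakk>E \<hookrightarrow> F; F \<subseteq> F'\<rbrakk> \<Longrightarrow> E \<hookrightarrow> F'"
  unfolding le_def embeds_def by blast

lemma embeds_subset: "\<lbrakk>embeds \<gamma> E F; E' \<in> sets M; E' \<subseteq> E\<rbrakk> \<Longrightarrow> embeds \<gamma> E' F"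
proof -
  assume a: "embeds \<gamma> E F" "E' \<in> sets M" "E' \<subseteq> E"
  have "{x \<in> E'. \<gamma> x = g} = E' \<inter> {x \<in> E. \<gamma> x = g}" for g using a by auto
  then show ?thesis using a unfolding embeds_def by (auto intro: inj_on_subset)
qed

lemma le_subset: "\<lbrakk>E \<hookrightarrow> F; E' \<in> sets M; E' \<subseteq> E\<rbrakk> \<Longrightarrow> E' \<hookrightarrow> F"
  unfolding le_def using embeds_subset by blast

lemma le_refl: "E \<in> sets M \<Longrightarrow> E \<hookrightarrow> E"
  using le_act_image[of E \<one>] sets.sets_into_space[of E M] image_cong[of E E "\<phi> \<one>" "\<lambda>x. x"]
  by (auto simp: subset_iff)

lemma subset_imp_le: "\<lbrakk>E \<in> sets M; E \<subseteq> F\<rbrakk> \<Longrightarrow> E \<hookrightarrow> F"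
  using le_refl le_mono by blast

lemma le_Int_invariant:
  assumes "E \<hookrightarrow> F" "invariant W" shows "E \<inter> W \<hookrightarrow> F \<inter> W"
proof -
  obtain \<gamma> where \<gamma>: "embeds \<gamma> E F" using assms by (auto simp: le_def)
  have "embeds \<gamma> (E \<inter> W) F" by (rule embeds_subset[OF \<gamma>]) (use \<gamma> assms in \<open>auto simp: embeds_def\<close>)
  then have "embeds \<gamma> (E \<inter> W) (F \<inter> W)" using assms(2) unfolding embeds_def invariant_def by auto
  then show ?thesis by (auto simp: le_def)
qed

lemma le_trans:
  assumes "E \<hookrightarrow> F" "F \<hookrightarrow> H" shows "E \<hookrightarrow> H"
proof -
  obtain \<gamma> \<delta> where g: "embeds \<gamma> E F" and d: "embeds \<delta> F H" using assms by (auto simp: le_def)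
  have E: "E \<in> sets M" "E \<subseteq> space M" using g sets.sets_into_space by (auto simp: embeds_def)
  define \<rho> where "\<rho> x = \<delta> (\<phi> (\<gamma> x) x) \<otimes> \<gamma> x" for x
  have \<rho>: "\<phi> (\<rho> x) x = \<phi> (\<delta> (\<phi> (\<gamma> x) x)) (\<phi> (\<gamma> x) x)" if "x \<in> E" for x
    using that E g d unfolding \<rho>_def embeds_def by (auto intro!: act_mult)
  have "embeds \<rho> E H" unfolding embeds_def
  proof (intro conjI ballI)
    show "\<rho> x \<in> carrier G" if "x \<in> E" for x using that g d by (auto simp: \<rho>_def embeds_def)
    show "\<phi> (\<rho> x) x \<in> H" if "x \<in> E" for x using that g d by (auto simp: \<rho> embeds_def)
    show "inj_on (\<lambda>x. \<phi> (\<rho> x) x) E"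
      using g d unfolding embeds_def by (auto simp: inj_on_def \<rho>)
    fix h assume h: "h \<in> carrier G"
    have space_Collect: "{x \<in> space M. x \<in> E \<and> P x} = {x \<in> E. P x}" for P using E by auto
    \<comment> \<open>Sorting by the value \<open>a\<close> of \<open>\<gamma>\<close> forces
      \<open>\<delta>\<close> to be \<open>h \<otimes> inv a\<close>; only countably many
      \<open>a\<close> occur.\<close>
    have "{x \<in> E. \<rho> x = h} = {x \<in> space M. \<exists>a\<in>carrier G. x \<in> {x\<in>E. \<gamma> x = a} \<and>
        \<phi> a x \<in> {y\<in>F. \<delta> y = h \<otimes> inv a}}"
      using g d E h unfolding \<rho>_def embeds_def
      by (auto simp: m_assoc intro!: inv_solve_right[THEN iffD2] inv_solve_right'[THEN iffD2])
    also have "\<dots> \<in> sets M"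
      using g d h E unfolding embeds_def
      by (intro sets.sets_Collect_countable_Ex' countable_carrier sets.sets_Collect_conj act_vimage_sets)
         (auto simp: space_Collect)
    finally show "{x \<in> E. \<rho> x = h} \<in> sets M" .
  qed (use E in auto)
  then show ?thesis by (auto simp: le_def)
qed

text \<open>The sources may overlap: each point uses the first \<open>E n\<close> containing it, and
  disjointness of the targets keeps images with different indices apart.\<close>

lemma le_UN:
  assumes le: "\<And>n::nat. E n \<hookrightarrow> F n" and disj: "disjoint_family F"
  shows "(\<Union>n. E n) \<hookrightarrow> (\<Union>n. F n)"
proof -
  obtain \<gamma> where \<gamma>: "\<And>n. embeds (\<gamma> n) (E n) (F n)" using le unfolding le_def by metis
  define k where "k x = (LEAST n. x \<in> E n)" for x
  define \<rho> where "\<rho> x = \<gamma> (k x) x" for x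
  have E [measurable]: "E n \<in> sets M" for n using \<gamma> by (auto simp: embeds_def)
  have k: "x \<in> E (k x)" if "x \<in> (\<Union>n. E n)" for x
    using that unfolding k_def by (auto intro: LeastI)
  have "embeds \<rho> (\<Union>n. E n) (\<Union>n. F n)" unfolding embeds_def
  proof (intro conjI ballI)
    have \<rho>: "\<rho> x \<in> carrier G \<and> \<phi> (\<rho> x) x \<in> F (k x)" if "x \<in> (\<Union>n. E n)" for x
      using k[OF that] \<gamma>[of "k x"] by (simp add: \<rho>_def embeds_def)
    show "\<rho> x \<in> carrier G" if "x \<in> (\<Union>n. E n)" for x using \<rho>[OF that] by blast
    show "\<phi> (\<rho> x) x \<in> (\<Union>n. F n)" if "x \<in> (\<Union>n. E n)" for x using \<rho>[OF that] by blast
    show "inj_on (\<lambda>x. \<phi> (\<rho> x) x) (\<Union>n. E n)"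
    proof (rule inj_onI)
      fix x y assume x: "x \<in> (\<Union>n. E n)" and y: "y \<in> (\<Union>n. E n)" and eq: "\<phi> (\<rho> x) x = \<phi> (\<rho> y) y"
      have "\<phi> (\<rho> x) x \<in> F (k x)" "\<phi> (\<rho> y) y \<in> F (k y)"
        using \<rho>[OF x] \<rho>[OF y] by auto
      then have kk: "k x = k y" using eq disj unfolding disjoint_family_on_def by (metis IntI UNIV_I empty_iff)
      then show "x = y" using k[OF x] k[OF y] \<gamma>[of "k y"] eq unfolding \<rho>_def embeds_def inj_on_def by metis
    qed
    fix g assume g: "g \<in> carrier G"
    have "{x \<in> (\<Union>n. E n). \<rho> x = g} = (\<Union>n. {x \<in> E n. \<gamma> n x = g} - (\<Union>m<n. E m))"
    proof (intro Set.set_eqI iffI)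
      fix x assume "x \<in> {x \<in> (\<Union>n. E n). \<rho> x = g}"
      then show "x \<in> (\<Union>n. {x \<in> E n. \<gamma> n x = g} - (\<Union>m<n. E m))"
        using k[of x] not_less_Least[of _ "\<lambda>n. x \<in> E n"]
        by (intro UN_I[of "k x"]) (auto simp: \<rho>_def simp flip: k_def)
    next
      fix x assume "x \<in> (\<Union>n. {x \<in> E n. \<gamma> n x = g} - (\<Union>m<n. E m))"
      then obtain n where n: "x \<in> E n" "\<gamma> n x = g" "\<And>m. m < n \<Longrightarrow> x \<notin> E m" by auto
      then have "k x = n" unfolding k_def by (intro Least_equality) (auto simp: not_less[symmetric])
      then show "x \<in> {x \<in> (\<Union>n. E n). \<rho> x = g}" using n by (auto simp: \<rho>_def)
    qed
    moreover have [measurable]: "{x \<in> E n. \<gamma> n x = g} \<in> sets M" for n using \<gamma>[of n] g by (simp add: embeds_def)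
    have "(\<Union>n. {x \<in> E n. \<gamma> n x = g} - (\<Union>m<n. E m)) \<in> sets M" by measurable
    ultimately show "{x \<in> (\<Union>n. E n). \<rho> x = g} \<in> sets M" by simp
  qed auto
  then show ?thesis by (auto simp: le_def)
qed

lemma le_Un:
  assumes "E1 \<hookrightarrow> F1" "E2 \<hookrightarrow> F2" "F1 \<inter> F2 = {}"
  shows "E1 \<union> E2 \<hookrightarrow> F1 \<union> F2"
proof -
  define E F where "E n = (if n = 0 then E1 else if n = 1 then E2 else {})"
    and "F n = (if n = 0 then F1 else if n = 1 then F2 else {})" for n :: nat
  have "(\<Union>n. E n) \<hookrightarrow> (\<Union>n. F n)"
  proof (rule le_UN)
    show "E n \<hookrightarrow> F n" for n using assms by (simp add: E_def F_def subset_imp_le)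
    show "disjoint_family F" using assms(3) unfolding disjoint_family_on_def F_def by (simp add: Int_commute)
  qed
  moreover have "(\<Union>n. E n) = E1 \<union> E2" "(\<Union>n. F n) = F1 \<union> F2"
    by (auto simp: E_def F_def split: if_splits)
  ultimately show ?thesis by simp
qed

lemma embeds_image:
  assumes "embeds \<gamma> E F" "B \<in> sets M" "B \<subseteq> E"
  shows "(\<lambda>x. \<phi> (\<gamma> x) x) ` B \<in> sets M" "B \<hookrightarrow> (\<lambda>x. \<phi> (\<gamma> x) x) ` B"
proof -
  have *: "embeds \<gamma> B F" using embeds_subset assms by blast
  have "(\<lambda>x. \<phi> (\<gamma> x) x) ` B = (\<Union>g\<in>carrier G. \<phi> g ` {x \<in> B. \<gamma> x = g})"
    using * by (auto simp: embeds_def)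
  also have "\<dots> \<in> sets M" using *
    by (intro sets.countable_UN' countable_carrier) (auto simp: embeds_def intro!: act_image_sets)
  finally show "(\<lambda>x. \<phi> (\<gamma> x) x) ` B \<in> sets M" .
  have "embeds \<gamma> B ((\<lambda>x. \<phi> (\<gamma> x) x) ` B)" using * unfolding embeds_def by auto
  then show "B \<hookrightarrow> (\<lambda>x. \<phi> (\<gamma> x) x) ` B" by (auto simp: le_def)
qed

text \<open>Iterate the embedding \<open>T\<close>. Since \<open>D\<close> misses \<open>F\<close>
  while \<open>T\<close> maps \<open>E\<close> into \<open>F\<close>, no later image of
  \<open>D\<close> meets \<open>D\<close>; injectivity carries this to any two images.\<close>

lemma compression_orbit:
  assumes le: "E \<hookrightarrow> F" and F: "F \<subseteq> E" and D: "D \<in> sets M" "D \<subseteq> E - F"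
  shows "\<exists>C :: nat \<Rightarrow> 'a set. disjoint_family C \<and> (\<forall>n. C n \<subseteq> E \<and> D \<hookrightarrow> C n)"
proof -
  obtain \<gamma> where \<gamma>: "embeds \<gamma> E F" using le by (auto simp: le_def)
  define T where "T x = \<phi> (\<gamma> x) x" for x
  define C where "C n = (T ^^ n) ` D" for n
  have T: "T x \<in> F" if "x \<in> E" for x using that \<gamma> by (auto simp: T_def embeds_def)
  have inj: "inj_on T E" using \<gamma> by (simp add: T_def[abs_def] embeds_def)
  have C: "C n \<in> sets M \<and> C n \<subseteq> E \<and> D \<hookrightarrow> C n" for n
  proof (induction n)
    case 0 then show ?case using D le_refl by (auto simp: C_def)
  next
    case (Suc n)
    have eq: "C (Suc n) = (\<lambda>x. \<phi> (\<gamma> x) x) ` C n" by (auto simp: C_def T_def)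
    have "C (Suc n) \<subseteq> E" using Suc T F by (auto simp: C_def)
    moreover have "C (Suc n) \<in> sets M" "D \<hookrightarrow> C (Suc n)"
      using Suc embeds_image[OF \<gamma>, of "C n"] le_trans unfolding eq by blast+
    ultimately show ?case by blast
  qed
  have pw: "C n \<inter> C m = {}" if "n < m" for n m
    using that
  proof (induction n arbitrary: m)
    case 0
    then obtain k where m: "m = Suc k" by (cases m) auto
    have "C m \<subseteq> F" using C[of k] T by (auto simp: m C_def)
    then show ?case using D by (auto simp: C_def)
  next
    case (Suc n)
    then obtain k where m: "m = Suc k" "n < k" by (cases m) auto
    have "C (Suc n) \<inter> C m = T ` C n \<inter> T ` C k" by (auto simp: C_def m)
    also have "\<dots> = T ` (C n \<inter> C k)" using C inj_on_image_Int[OF inj] by metis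
    finally show ?case using Suc.IH[OF m(2)] by auto
  qed
  have "disjoint_family C" unfolding disjoint_family_on_def using pw by (metis Int_commute linorder_neqE_nat)
  then show ?thesis using C by blast
qed

text \<open>The state is the pair of still unmatched parts. Stage \<open>k\<close> matches all
  possible \<open>x\<close> with \<open>\<phi> g x\<close> at once; there is no conflict since
  translation by \<open>g\<close> is injective. No choice depends on the point, which is why
  \<open>greedy_pullback\<close> holds.\<close>

primrec greedy :: "'a set \<Rightarrow> 'a set \<Rightarrow> nat \<Rightarrow> 'a set \<times> 'a set" where
  "greedy \<alpha> \<beta> 0 = (\<alpha>, \<beta>)"
| "greedy \<alpha> \<beta> (Suc k) =
     (let U = fst (greedy \<alpha> \<beta> k); V = snd (greedy \<alpha> \<beta> k); g = from_nat_into (carrier G) k;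
          P = {x \<in> U. \<phi> g x \<in> V} in (U - P, V - \<phi> g ` P))"

definition rest1 :: "'a set \<Rightarrow> 'a set \<Rightarrow> 'a set" where
  "rest1 \<alpha> \<beta> = (\<Inter>k. fst (greedy \<alpha> \<beta> k))"

definition rest2 :: "'a set \<Rightarrow> 'a set \<Rightarrow> 'a set" where
  "rest2 \<alpha> \<beta> = (\<Inter>k. snd (greedy \<alpha> \<beta> k))"

definition full1 :: "'a set \<Rightarrow> 'a set \<Rightarrow> 'a set" where
  "full1 \<alpha> \<beta> = {x \<in> space M. \<forall>g\<in>carrier G. \<phi> g x \<notin> rest1 \<alpha> \<beta>}"

definition full2 :: "'a set \<Rightarrow> 'a set \<Rightarrow> 'a set" where
  "full2 \<alpha> \<beta> = {x \<in> space M. \<forall>g\<in>carrier G. \<phi> g x \<notin> rest2 \<alpha> \<beta>}"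

lemma enum_in_carrier [simp]: "from_nat_into (carrier G) k \<in> carrier G"
  by (rule from_nat_into) auto

context
  fixes \<alpha> \<beta> assumes \<alpha>\<beta>: "\<alpha> \<in> sets M" "\<beta> \<in> sets M"
begin

lemma greedy_sets: "fst (greedy \<alpha> \<beta> k) \<in> sets M \<and> snd (greedy \<alpha> \<beta> k) \<in> sets M"
proof (induction k)
  case (Suc k)
  let ?U = "fst (greedy \<alpha> \<beta> k)" and ?V = "snd (greedy \<alpha> \<beta> k)" and ?g = "from_nat_into (carrier G) k"
  have "{x \<in> ?U. \<phi> ?g x \<in> ?V} = ?U \<inter> {x \<in> space M. \<phi> ?g x \<in> ?V}"
    using Suc sets.sets_into_space by blast
  then have "{x \<in> ?U. \<phi> ?g x \<in> ?V} \<in> sets M" using Suc by (auto intro: act_vimage_sets)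
  then show ?case using Suc by (auto simp: Let_def intro!: act_image_sets)
qed (use \<alpha>\<beta> in auto)

lemma rest_sets: "rest1 \<alpha> \<beta> \<in> sets M" "rest2 \<alpha> \<beta> \<in> sets M"
  using greedy_sets unfolding rest1_def rest2_def by auto

lemma rest_subset: "rest1 \<alpha> \<beta> \<subseteq> \<alpha>" "rest2 \<alpha> \<beta> \<subseteq> \<beta>"
  unfolding rest1_def rest2_def by (auto dest: INT_D[of _ _ _ 0])

lemma invariant_full: "invariant (full1 \<alpha> \<beta>)" "invariant (full2 \<alpha> \<beta>)"
  unfolding full1_def full2_def using rest_sets invariant_avoiding by auto

text \<open>At the stage whose group element is \<open>g\<close>, the points \<open>x\<close> and
  \<open>\<phi> g x\<close>, both still free, would have been matched.\<close>

lemma rest_disjoint: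
  assumes "x \<in> rest1 \<alpha> \<beta>" "g \<in> carrier G" shows "\<phi> g x \<notin> rest2 \<alpha> \<beta>"
proof
  assume r: "\<phi> g x \<in> rest2 \<alpha> \<beta>"
  obtain k where k: "from_nat_into (carrier G) k = g"
    using from_nat_into_surj[OF countable_carrier assms(2)] by blast
  have "x \<in> fst (greedy \<alpha> \<beta> k)" "\<phi> g x \<in> snd (greedy \<alpha> \<beta> k)" "x \<in> fst (greedy \<alpha> \<beta> (Suc k))"
    using assms(1) r unfolding rest1_def rest2_def by blast+
  then show False using k by (simp add: Let_def)
qed

text \<open>The comparison dichotomy: leftovers of both kinds on one orbit differ by a single group
  element, contrary to \<open>rest_disjoint\<close>.\<close>

lemma full_Un: "full1 \<alpha> \<beta> \<union> full2 \<alpha> \<beta> = space M"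
proof -
  have False if x: "x \<in> space M" and g: "g \<in> carrier G" "\<phi> g x \<in> rest1 \<alpha> \<beta>"
    and h: "h \<in> carrier G" "\<phi> h x \<in> rest2 \<alpha> \<beta>" for x g h
  proof -
    have "\<phi> (h \<otimes> inv g) (\<phi> g x) = \<phi> h x" using x g h by (simp add: act_mult)
    then show False using rest_disjoint[OF g(2), of "h \<otimes> inv g"] g h by simp
  qed
  then show ?thesis unfolding full1_def full2_def by blast
qed

text \<open>Stage \<open>k\<close> removes a set on one side and its translate on the other. The
  removed layers are disjoint on both sides, so the translations glue in either direction.\<close>

lemma greedy_match: "\<alpha> - rest1 \<alpha> \<beta> \<hookrightarrow> \<beta> - rest2 \<alpha> \<beta>" "\<beta> - rest2 \<alpha> \<beta> \<hookrightarrow> \<alpha> - rest1 \<alpha> \<beta>"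
proof -
  define U V where "U k = fst (greedy \<alpha> \<beta> k)" and "V k = snd (greedy \<alpha> \<beta> k)" for k
  let ?g = "from_nat_into (carrier G)"
  have Us: "U k \<in> sets M" "V k \<in> sets M" for k using greedy_sets by (auto simp: U_def V_def)
  have dec: "U (Suc k) \<subseteq> U k" "V (Suc k) \<subseteq> V k" for k by (auto simp: U_def V_def Let_def)
  have P: "U k - U (Suc k) = {x \<in> U k. \<phi> (?g k) x \<in> V k}"
    "V k - V (Suc k) = \<phi> (?g k) ` {x \<in> U k. \<phi> (?g k) x \<in> V k}" for k
    by (auto simp: U_def V_def Let_def)
  have Q: "V k - V (Suc k) = \<phi> (?g k) ` (U k - U (Suc k))" for k by (simp add: P)
  have "U k - U (Suc k) \<hookrightarrow> V k - V (Suc k)" "V k - V (Suc k) \<hookrightarrow> U k - U (Suc k)" for k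
    unfolding Q using le_act_image[of "U k - U (Suc k)"] act_image_le[of "U k - U (Suc k)"] Us by auto
  then have "(\<Union>k. U k - U (Suc k)) \<hookrightarrow> (\<Union>k. V k - V (Suc k))" "(\<Union>k. V k - V (Suc k)) \<hookrightarrow> (\<Union>k. U k - U (Suc k))"
    by (intro le_UN disjoint_family_diff_decseq dec; blast)+
  moreover have "\<alpha> - rest1 \<alpha> \<beta> = (\<Union>k. U k - U (Suc k))" "\<beta> - rest2 \<alpha> \<beta> = (\<Union>k. V k - V (Suc k))"
    using Diff_INT_decseq[of U] Diff_INT_decseq[of V] dec by (auto simp: rest1_def rest2_def U_def V_def)
  ultimately show "\<alpha> - rest1 \<alpha> \<beta> \<hookrightarrow> \<beta> - rest2 \<alpha> \<beta>" "\<beta> - rest2 \<alpha> \<beta> \<hookrightarrow> \<alpha> - rest1 \<alpha> \<beta>" by auto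
qed

lemma full1_disjoint: "full1 \<alpha> \<beta> \<inter> rest1 \<alpha> \<beta> = {}" "full2 \<alpha> \<beta> \<inter> rest2 \<alpha> \<beta> = {}"
  unfolding full1_def full2_def by (auto dest: bspec[of _ _ \<one>])

lemma full1_le: "invariant W \<Longrightarrow> W \<subseteq> full1 \<alpha> \<beta> \<Longrightarrow> \<alpha> \<inter> W \<hookrightarrow> \<beta> \<inter> W"
proof -
  assume W: "invariant W" "W \<subseteq> full1 \<alpha> \<beta>"
  have "(\<alpha> - rest1 \<alpha> \<beta>) \<inter> W = \<alpha> \<inter> W" using full1_disjoint W by blast
  then show ?thesis using le_mono[OF le_Int_invariant[OF greedy_match(1) W(1)], of "\<beta> \<inter> W"] by auto
qed

lemma full2_le: "invariant W \<Longrightarrow> W \<subseteq> full2 \<alpha> \<beta> \<Longrightarrow> \<beta> \<inter> W \<hookrightarrow> \<alpha> \<inter> W"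
proof -
  assume W: "invariant W" "W \<subseteq> full2 \<alpha> \<beta>"
  have "(\<beta> - rest2 \<alpha> \<beta>) \<inter> W = \<beta> \<inter> W" using full1_disjoint W by blast
  then show ?thesis using le_mono[OF le_Int_invariant[OF greedy_match(2) W(1)], of "\<alpha> \<inter> W"] by auto
qed

end

end

section \<open>Tokens and compressions\<close>

text \<open>Each stage only tests membership of translates, which preimages under an equivariant map
  respect. The two inclusions are carried through the induction so that \<open>act_image_eq\<close>
  applies at the next stage.\<close>

lemma greedy_pullback:
  assumes M: "meas_action G M \<phi>" and N: "meas_action G N \<psi>"
    and f: "f \<in> space M \<rightarrow> space N"
    and eqv: "\<And>g x. g \<in> carrier G \<Longrightarrow> x \<in> space M \<Longrightarrow> f (\<phi> g x) = \<psi> g (f x)"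
    and \<alpha>\<beta>: "\<alpha> \<subseteq> space N" "\<beta> \<subseteq> space N"
  shows "meas_action.greedy G \<phi> (f -` \<alpha> \<inter> space M) (f -` \<beta> \<inter> space M) k =
    (f -` fst (meas_action.greedy G \<psi> \<alpha> \<beta> k) \<inter> space M, f -` snd (meas_action.greedy G \<psi> \<alpha> \<beta> k) \<inter> space M)
    \<and> fst (meas_action.greedy G \<psi> \<alpha> \<beta> k) \<subseteq> space N \<and> snd (meas_action.greedy G \<psi> \<alpha> \<beta> k) \<subseteq> space N"
proof (induction k)
  interpret M: meas_action G M \<phi> by fact
  interpret N: meas_action G N \<psi> by fact
  case 0 then show ?case using \<alpha>\<beta> by simp
next
  interpret M: meas_action G M \<phi> by fact
  interpret N: meas_action G N \<psi> by fact
  case (Suc k)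
  define U V where "U = fst (N.greedy \<alpha> \<beta> k)" and "V = snd (N.greedy \<alpha> \<beta> k)"
  define g where "g = from_nat_into (carrier G) k"
  have g: "g \<in> carrier G" by (simp add: g_def)
  have UV: "U \<subseteq> space N" "V \<subseteq> space N" using Suc by (auto simp: U_def V_def)
  define P where "P = {x \<in> U. \<psi> g x \<in> V}"
  have N: "N.greedy \<alpha> \<beta> (Suc k) = (U - P, V - \<psi> g ` P)"
    by (simp add: U_def V_def g_def P_def Let_def)
  have P: "{x \<in> f -` U \<inter> space M. \<phi> g x \<in> f -` V \<inter> space M} = f -` P \<inter> space M"
    using eqv g by (auto simp: P_def)
  \<comment> \<open>Images and preimages do not commute in general; here the translate is rewritten
    as a preimage under \<open>inv g\<close>, where equivariance suffices.\<close>
  have "\<phi> g ` (f -` P \<inter> space M) = f -` (\<psi> g ` P) \<inter> space M"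
    using g UV P_def f eqv[of "inv\<^bsub>G\<^esub> g"] by (subst M.act_image_eq, simp, simp, subst N.act_image_eq) auto
  moreover have "M.greedy (f -` \<alpha> \<inter> space M) (f -` \<beta> \<inter> space M) (Suc k) =
     (f -` U \<inter> space M - f -` P \<inter> space M, f -` V \<inter> space M - \<phi> g ` (f -` P \<inter> space M))"
    using Suc P by (simp add: U_def V_def g_def Let_def)
  ultimately show ?case using UV g N.act_space unfolding N
    by (simp add: Diff_Int_distrib2 vimage_Diff Int_commute Diff_Int_distrib subset_iff)
qed

lemma full_pullback:
  assumes M: "meas_action G M \<phi>" and N: "meas_action G N \<psi>"
    and f: "f \<in> space M \<rightarrow> space N"
    and eqv: "\<And>g x. g \<in> carrier G \<Longrightarrow> x \<in> space M \<Longrightarrow> f (\<phi> g x) = \<psi> g (f x)"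
    and \<alpha>\<beta>: "\<alpha> \<subseteq> space N" "\<beta> \<subseteq> space N" and x: "x \<in> space M"
  shows "x \<in> meas_action.full1 G M \<phi> (f -` \<alpha> \<inter> space M) (f -` \<beta> \<inter> space M) \<longleftrightarrow> f x \<in> meas_action.full1 G N \<psi> \<alpha> \<beta>"
    and "x \<in> meas_action.full2 G M \<phi> (f -` \<alpha> \<inter> space M) (f -` \<beta> \<inter> space M) \<longleftrightarrow> f x \<in> meas_action.full2 G N \<psi> \<alpha> \<beta>"
proof -
  interpret M: meas_action G M \<phi> by fact
  interpret N: meas_action G N \<psi> by fact
  have *: "M.greedy (f -` \<alpha> \<inter> space M) (f -` \<beta> \<inter> space M) k =
    (f -` fst (N.greedy \<alpha> \<beta> k) \<inter> space M, f -` snd (N.greedy \<alpha> \<beta> k) \<inter> space M)" for k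
    using greedy_pullback[OF M N f _ \<alpha>\<beta>, of k] eqv by blast
  have r: "y \<in> M.rest1 (f -` \<alpha> \<inter> space M) (f -` \<beta> \<inter> space M) \<longleftrightarrow> f y \<in> N.rest1 \<alpha> \<beta>"
    "y \<in> M.rest2 (f -` \<alpha> \<inter> space M) (f -` \<beta> \<inter> space M) \<longleftrightarrow> f y \<in> N.rest2 \<alpha> \<beta>" if "y \<in> space M" for y
    using that unfolding M.rest1_def N.rest1_def M.rest2_def N.rest2_def by (simp_all add: *)
  have fx: "f x \<in> space N" using f x by auto
  show "x \<in> M.full1 (f -` \<alpha> \<inter> space M) (f -` \<beta> \<inter> space M) \<longleftrightarrow> f x \<in> N.full1 \<alpha> \<beta>"
    "x \<in> M.full2 (f -` \<alpha> \<inter> space M) (f -` \<beta> \<inter> space M) \<longleftrightarrow> f x \<in> N.full2 \<alpha> \<beta>"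
    unfolding M.full1_def N.full1_def M.full2_def N.full2_def by (simp_all add: r eqv x fx)
qed

text \<open>The pair \<open>(x, i)\<close> stands for the \<open>i\<close>-th copy of the point \<open>x\<close>. With the integers moving the copies,
  multiples of sets are sets in another countable group action, to which the matching applies as it is.\<close>

definition token_act :: "('g \<Rightarrow> 'a \<Rightarrow> 'a) \<Rightarrow> 'g \<times> int \<Rightarrow> 'a \<times> int \<Rightarrow> 'a \<times> int" where
  "token_act \<phi> = (\<lambda>(g, d) (x, i). (\<phi> g x, d + i))"

lemma token_act_simp [simp]: "token_act \<phi> (g, d) (x, i) = (\<phi> g x, d + i)"
  by (simp add: token_act_def)

text \<open>The second instance follows from the first by \<open>token_actionI\<close>; the locale
  makes matching of points and matching of tokens available side by side.\<close>

locale token_action = meas_action G M \<phi> +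
  tk: meas_action "G \<times>\<times> integer_group" "M \<Otimes>\<^sub>M count_space UNIV" "token_act \<phi>"
  for G :: "('g, 'm) monoid_scheme" (structure) and M :: "'a measure" and \<phi> :: "'g \<Rightarrow> 'a \<Rightarrow> 'a"

lemma token_actionI:
  assumes "meas_action G M \<phi>"
  shows "token_action G M \<phi>"
proof -
  interpret meas_action G M \<phi> by fact
  have "group (G \<times>\<times> integer_group)" by (intro DirProd_group is_group group_integer_group)
  moreover have "token_act \<phi> (g, d) \<in> measurable (M \<Otimes>\<^sub>M count_space UNIV) (M \<Otimes>\<^sub>M count_space UNIV)"
    if "g \<in> carrier G" for g d
  proof -
    have [measurable]: "\<phi> g \<in> measurable M M" using that by (rule act_meas)
    have "token_act \<phi> (g, d) = (\<lambda>z. (\<phi> g (fst z), d + snd z))" by (auto simp: token_act_def)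
    then show ?thesis by simp
  qed
  ultimately have "meas_action (G \<times>\<times> integer_group) (M \<Otimes>\<^sub>M count_space UNIV) (token_act \<phi>)"
    using countable_carrier
    by (intro meas_action.intro meas_action_axioms.intro)
       (auto simp: space_pair_measure act_mult)
  then show ?thesis using assms by (simp add: token_action_def)
qed

context token_action
begin

abbreviation "TM \<equiv> M \<Otimes>\<^sub>M (count_space UNIV :: int measure)"

abbreviation "H \<equiv> G \<times>\<times> integer_group"

definition base :: "('a \<times> int) set \<Rightarrow> 'a set" where
  "base F = {x \<in> space M. (x, 0) \<in> F}"

lemma space_TM [simp]: "space TM = space M \<times> UNIV"
  by (simp add: space_pair_measure)

lemma Times_sets [simp, intro]: "A \<in> sets M \<Longrightarrow> A \<times> I \<in> sets TM"
  by (intro pair_measureI) auto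

lemma section_sets:
  assumes "Q \<in> sets TM" shows "{x \<in> space M. (x, i) \<in> Q} \<in> sets M"
proof -
  have "(\<lambda>x. (x, i)) \<in> measurable M TM" by simp
  from measurable_sets[OF this assms] show ?thesis by (simp add: vimage_def Int_def conj_commute)
qed

text \<open>The integer \<open>n\<close> moves copy 0 of a point to copy \<open>n\<close>, so an
  invariant set of tokens contains all copies of a point or none.\<close>

lemma base_iff: "tk.invariant F \<Longrightarrow> x \<in> space M \<Longrightarrow> (x, n) \<in> F \<longleftrightarrow> x \<in> base F"
  using tk.invariant_iff[of F "(\<one>, n)" "(x, 0)"] by (simp add: base_def)

lemma base_Times: "tk.invariant F \<Longrightarrow> base F \<times> UNIV = F"
  using base_iff[of F] sets.sets_into_space[of F TM] by (auto simp: base_def)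

lemma invariant_base:
  assumes "tk.invariant F" shows "invariant (base F)"
  unfolding invariant_def
proof (intro conjI ballI)
  show "base F \<in> sets M" using section_sets[of F 0] assms by (simp add: base_def)
  show "\<phi> g x \<in> base F" if "g \<in> carrier G" "x \<in> base F" for g x
    using tk.invariant_iff[OF assms, of "(g, 0)" "(x, 0)"] that by (auto simp: base_def)
qed

lemma invariant_Times: "invariant W \<Longrightarrow> tk.invariant (W \<times> UNIV)"
  unfolding tk.invariant_def by (auto simp: invariant_def)

section \<open>Comparison of multiples of sets\<close>

definition tok :: "'a set \<Rightarrow> nat \<Rightarrow> ('a \<times> int) set" where
  "tok A q = A \<times> {0..<int q}"

text \<open>The inequality \<open>q [A] \<le> p [B]\<close> of Tarski's type semigroup, in its
  countable Borel version.\<close>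

definition tle :: "'a set \<Rightarrow> nat \<Rightarrow> 'a set \<Rightarrow> nat \<Rightarrow> bool" where
  "tle A q B p \<longleftrightarrow> tk.le (tok A q) (tok B p)"

lemma tok_sets [simp, intro]: "A \<in> sets M \<Longrightarrow> tok A q \<in> sets TM"
  by (simp add: tok_def)

lemma le_shift: 
  assumes "A \<in> sets M" shows "tk.le (A \<times> I) (A \<times> ((+) d ` I))"
proof -
  have "token_act \<phi> (\<one>, d) ` (A \<times> I) = A \<times> ((+) d ` I)"
    using sets.sets_into_space[OF assms] by (force simp: image_def)
  then show ?thesis using tk.le_act_image[of "A \<times> I" "(\<one>, d)"] assms by auto
qed

lemma tle_subset: "\<lbrakk>A \<in> sets M; A \<subseteq> B; q \<le> p\<rbrakk> \<Longrightarrow> tle A q B p"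
  unfolding tle_def by (intro tk.subset_imp_le) (auto simp: tok_def)

lemma tle_trans: "\<lbrakk>tle A q B p; tle B p C r\<rbrakk> \<Longrightarrow> tle A q C r"
  unfolding tle_def by (rule tk.le_trans)

text \<open>The tokens of \<open>B\<close> are sent to the copies of \<open>C\<close> numbered from
  \<open>a\<close> on. This separates the targets, so \<open>A\<close> and \<open>B\<close> may
  overlap.\<close>

lemma tle_Un_left:
  assumes "tle A q C a" "tle B q C b" "C \<in> sets M"
  shows "tle (A \<union> B) q C (a + b)"
proof -
  have sh: "(+) (int a) ` {0..<int b} = {int a..<int (a + b)}" by (simp add: add.commute)
  have "tk.le (tok B q) (C \<times> {int a..<int (a + b)})"
    using tk.le_trans[OF assms(2)[unfolded tle_def] le_shift[OF assms(3), of "{0..<int b}" "int a", folded tok_def]]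
    unfolding sh by simp
  then have "tk.le (tok A q \<union> tok B q) (tok C a \<union> C \<times> {int a..<int (a + b)})"
    using assms(1) unfolding tle_def by (intro tk.le_Un) (auto simp: tok_def)
  moreover have "tok A q \<union> tok B q = tok (A \<union> B) q" "tok C a \<union> C \<times> {int a..<int (a + b)} = tok C (a + b)"
    by (auto simp: tok_def)
  ultimately show ?thesis by (simp add: tle_def)
qed

lemma tok_add: "tok A (a + b) = tok A a \<union> A \<times> {int a..<int (a + b)}"
  by (auto simp: tok_def)

lemma tok_tail_le:
  assumes "A \<in> sets M" shows "tk.le (A \<times> {int a..<int (a + b)}) (tok A b)"
proof -
  have "(+) (- int a) ` {int a..<int (a + b)} = {0..<int b}"
    using image_add_atLeastLessThan[of "- int a" "int a" "int (a + b)"] by simp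
  then show ?thesis using le_shift[OF assms, of "{int a..<int (a + b)}" "- int a"] by (simp only: tok_def)
qed

lemma tok_tail_ge:
  assumes "A \<in> sets M" shows "tk.le (tok A b) (A \<times> {int a..<int (a + b)})"
proof -
  have "(+) (int a) ` {0..<int b} = {int a..<int (a + b)}" by (simp add: add.commute)
  then show ?thesis using le_shift[OF assms, of "{0..<int b}" "int a"] by (simp only: tok_def)
qed

text \<open>Here both targets use the same copy numbers, so disjointness of \<open>A\<close> and
  \<open>B\<close> has to separate them.\<close>

lemma tle_Un_right:
  assumes "tle C a A q" "tle C b B q" "A \<inter> B = {}" "C \<in> sets M"
  shows "tle C (a + b) (A \<union> B) q"
proof -
  have "tk.le (C \<times> {int a..<int (a + b)}) (tok B q)"
    using tk.le_trans[OF tok_tail_le] assms by (simp add: tle_def)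
  then have "tk.le (tok C (a + b)) (tok A q \<union> tok B q)"
    unfolding tok_add using assms by (intro tk.le_Un) (auto simp: tle_def tok_def)
  moreover have "tok A q \<union> tok B q = tok (A \<union> B) q" by (auto simp: tok_def)
  ultimately show ?thesis by (simp add: tle_def)
qed

lemma tle_add:
  assumes "tle A a B b" "tle A c B d" "A \<in> sets M" "B \<in> sets M"
  shows "tle A (a + c) B (b + d)"
  unfolding tle_def tok_add
proof (rule tk.le_Un)
  show "tk.le (tok A a) (tok B b)" using assms(1) by (simp add: tle_def)
  show "tk.le (A \<times> {int a..<int (a + c)}) (B \<times> {int b..<int (b + d)})"
    using tk.le_trans[OF tok_tail_le[OF assms(3)] tk.le_trans[OF assms(2)[unfolded tle_def] tok_tail_ge[OF assms(4)]]] .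
qed (auto simp: tok_def)

lemma tle_mult:
  assumes "tle A a B b" "A \<in> sets M" "B \<in> sets M"
  shows "tle A (c * a) B (c * b)"
proof (induction c)
  case 0 then show ?case by (auto simp: tle_def tok_def intro: tk.subset_imp_le)
qed (use assms tle_add in auto)

lemma tle_act_image:
  assumes "A \<in> sets M" "g \<in> carrier G"
  shows "tle A q (\<phi> g ` A) q"
proof -
  have "token_act \<phi> (g, 0) ` tok A q = tok (\<phi> g ` A) q"
    by (force simp: tok_def)
  then show ?thesis using tk.le_act_image[of "tok A q" "(g, 0)"] assms by (auto simp: tle_def)
qed

text \<open>Membership in \<open>up A q p\<close> is read as \<open>m(A) \<le> p/q\<close> on the
  orbit of the point, membership in \<open>dn A q p\<close> as \<open>m(A) \<ge> p/q\<close>. By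
  \<open>up_Un_dn\<close> at least one of them holds everywhere.\<close>

definition up :: "'a set \<Rightarrow> nat \<Rightarrow> nat \<Rightarrow> 'a set" where
  "up A q p = base (tk.full1 (tok A q) (tok (space M) p))"

definition dn :: "'a set \<Rightarrow> nat \<Rightarrow> nat \<Rightarrow> 'a set" where
  "dn A q p = base (tk.full2 (tok A q) (tok (space M) p))"

context
  fixes A assumes A: "A \<in> sets M"
begin

lemma invariant_up: "invariant (up A q p)" and invariant_dn: "invariant (dn A q p)"
  unfolding up_def dn_def using A by (auto intro!: invariant_base tk.invariant_full)

lemma up_Un_dn: "up A q p \<union> dn A q p = space M"
  using tk.full_Un[of "tok A q" "tok (space M) p"] A by (fastforce simp: up_def dn_def base_def)

lemma up_tle:
  assumes W: "invariant W" "W \<subseteq> up A q p" shows "tle (A \<inter> W) q W p"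
proof -
  let ?F = "tk.full1 (tok A q) (tok (space M) p)"
  have "W \<times> UNIV \<subseteq> ?F" using base_Times[of ?F] W A by (auto simp: up_def tk.invariant_full)
  then have "tk.le (tok A q \<inter> W \<times> UNIV) (tok (space M) p \<inter> W \<times> UNIV)"
    using A W by (intro tk.full1_le invariant_Times) auto
  moreover have "tok A q \<inter> W \<times> UNIV = tok (A \<inter> W) q" "tok (space M) p \<inter> W \<times> UNIV = tok W p"
    using W sets.sets_into_space[of W M] by (auto simp: tok_def)
  ultimately show ?thesis by (simp add: tle_def)
qed

lemma dn_tle:
  assumes W: "invariant W" "W \<subseteq> dn A q p" shows "tle W p (A \<inter> W) q"
proof -
  let ?F = "tk.full2 (tok A q) (tok (space M) p)"
  have "W \<times> UNIV \<subseteq> ?F" using base_Times[of ?F] W A by (auto simp: dn_def tk.invariant_full)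
  then have "tk.le (tok (space M) p \<inter> W \<times> UNIV) (tok A q \<inter> W \<times> UNIV)"
    using A W by (intro tk.full2_le invariant_Times) auto
  moreover have "tok A q \<inter> W \<times> UNIV = tok (A \<inter> W) q" "tok (space M) p \<inter> W \<times> UNIV = tok W p"
    using W sets.sets_into_space[of W M] by (auto simp: tok_def)
  ultimately show ?thesis by (simp add: tle_def)
qed

end

text \<open>Some point on each orbit in \<open>W\<close> owns infinitely many places, disjoint from those of all other points:
  the elements of \<open>Q\<close> are the pairs of an owner and the number of a place.\<close>

definition traveling :: "'a set \<Rightarrow> bool" where
  "traveling W \<longleftrightarrow> (\<exists>Q. tk.le Q (space M \<times> {0}) \<and>
     (\<forall>x\<in>W. \<exists>g\<in>carrier G. infinite {n::nat. (\<phi> g x, int n) \<in> Q}))"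

lemma traveling_mono: "\<lbrakk>traveling W; V \<subseteq> W\<rbrakk> \<Longrightarrow> traveling V"
  unfolding traveling_def by blast

text \<open>Make the sets disjoint and keep from \<open>Q n\<close> only the owners in the
  \<open>n\<close>-th part. Embeddings move points inside orbits and the parts are invariant, so
  places of different parts cannot collide.\<close>

lemma traveling_UN:
  assumes W: "\<And>n::nat. traveling (W n)" "\<And>n. invariant (W n)"
  shows "traveling (\<Union>n. W n)"
proof -
  obtain Q where Q: "\<And>n. tk.le (Q n) (space M \<times> {0})"
    "\<And>n x. x \<in> W n \<Longrightarrow> \<exists>g\<in>carrier G. infinite {k::nat. (\<phi> g x, int k) \<in> Q n}"
    using W(1) unfolding traveling_def by metis
  define D where "D = disjointed W"
  have D: "invariant (D n)" "D n \<subseteq> W n" for n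
    using invariant_disjointed[of W] W(2) disjointed_subset[of W n] by (auto simp: D_def)
  have "tk.le (Q n \<inter> D n \<times> UNIV) (space M \<times> {0} \<inter> D n \<times> UNIV)" for n
    using Q D by (intro tk.le_Int_invariant invariant_Times)
  moreover have "disjoint_family (\<lambda>n. space M \<times> {0::int} \<inter> D n \<times> UNIV)"
    using disjoint_family_disjointed[of W] unfolding D_def disjoint_family_on_def by blast
  ultimately have "tk.le (\<Union>n. Q n \<inter> D n \<times> UNIV) (\<Union>n. space M \<times> {0} \<inter> D n \<times> UNIV)"
    by (rule tk.le_UN)
  then have "tk.le (\<Union>n. Q n \<inter> D n \<times> UNIV) (space M \<times> {0})" by (rule tk.le_mono) auto
  moreover have "\<exists>g\<in>carrier G. infinite {k::nat. (\<phi> g x, int k) \<in> (\<Union>n. Q n \<inter> D n \<times> UNIV)}"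
    if x: "x \<in> (\<Union>n. W n)" for x
  proof -
    have "x \<in> (\<Union>n. D n)" using x UN_disjointed_eq[of W] by (simp add: D_def)
    then obtain n where n: "x \<in> D n" by blast
    then obtain g where g: "g \<in> carrier G" "infinite {k::nat. (\<phi> g x, int k) \<in> Q n}" using Q(2) D(2) by blast
    have "\<phi> g x \<in> D n" using D(1) g n unfolding invariant_def by blast
    then have "{k::nat. (\<phi> g x, int k) \<in> Q n} \<subseteq> {k. (\<phi> g x, int k) \<in> (\<Union>n. Q n \<inter> D n \<times> UNIV)}" by auto
    then show ?thesis using g infinite_super by blast
  qed
  ultimately show ?thesis unfolding traveling_def by blast
qed

lemma traveling_empty: "traveling {}"
  unfolding traveling_def by (intro exI[of _ "{}"]) (auto intro: tk.subset_imp_le)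

lemma traveling_countable_Union:
  assumes "countable \<W>" "\<And>W. W \<in> \<W> \<Longrightarrow> traveling W" "\<And>W. W \<in> \<W> \<Longrightarrow> invariant W"
  shows "traveling (\<Union>\<W>)"
proof (cases "\<W> = {}")
  case False
  then have "\<Union>\<W> = (\<Union>n. from_nat_into \<W> n)" using range_from_nat_into[OF False assms(1)] by metis
  then show ?thesis using traveling_UN[of "from_nat_into \<W>"] assms from_nat_into[OF False] by simp
qed (simp add: traveling_empty)

text \<open>Pigeonhole: at every point infinitely many of the tokens land in one of the \<open>N\<close> slots, and the tokens
  landing in a fixed slot are disjoint places of the space.\<close>

lemma traveling_slots:
  assumes W: "invariant W" and le: "tk.le (W \<times> {0..}) (tok W N)"
  shows "traveling W"
proof -
  obtain \<gamma> where \<gamma>: "tk.embeds \<gamma> (W \<times> {0..}) (tok W N)" using le by (auto simp: tk.le_def)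
  define Q where "Q j = {z \<in> W \<times> {0..}. snd (token_act \<phi> (\<gamma> z) z) = j}" for j
  have Qs: "Q j \<in> sets TM" for j
  proof -
    \<comment> \<open>The landing slot is the integer part of \<open>\<gamma> z\<close> plus the old
      index, so fixing the value of \<open>\<gamma>\<close> makes the condition a rectangle.\<close>
    have "Q j = (\<Union>h\<in>carrier H. {z \<in> W \<times> {0..}. \<gamma> z = h} \<inter> space M \<times> {i. snd h + i = j})"
    proof (intro Set.set_eqI iffI)
      fix z assume z: "z \<in> Q j"
      obtain x i where xi: "z = (x, i)" by (cases z)
      obtain g d where gd: "\<gamma> z = (g, d)" by (cases "\<gamma> z")
      have "\<gamma> z \<in> carrier H" "x \<in> space M" using z \<gamma> sets.sets_into_space[of W M] W by (auto simp: Q_def tk.embeds_def xi)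
      then show "z \<in> (\<Union>h\<in>carrier H. {z \<in> W \<times> {0..}. \<gamma> z = h} \<inter> space M \<times> {i. snd h + i = j})"
        using z gd by (auto simp: Q_def xi)
    qed (auto simp: Q_def)
    also have "\<dots> \<in> sets TM" using \<gamma>
      by (intro sets.countable_UN' tk.countable_carrier sets.Int Times_sets)
         (auto simp: tk.embeds_def simp del: carrier_DirProd)
    finally show ?thesis .
  qed
  have Qle: "tk.le (Q j) (space M \<times> {0})" for j
  proof -
    have "tk.embeds \<gamma> (Q j) (tok W N)" by (rule tk.embeds_subset[OF \<gamma> Qs]) (auto simp: Q_def)
    moreover have "token_act \<phi> (\<gamma> z) z \<in> W \<times> {j}" if "z \<in> Q j" "token_act \<phi> (\<gamma> z) z \<in> tok W N" for z
      using that by (auto simp: Q_def tok_def mem_Times_iff)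
    ultimately have "tk.embeds \<gamma> (Q j) (W \<times> {j})" unfolding tk.embeds_def by blast
    then have 1: "tk.le (Q j) (W \<times> {j})" by (auto simp: tk.le_def)
    have 2: "tk.le (W \<times> {j}) (W \<times> {0})" using le_shift[of W "{j}" "-j"] W by simp
    show ?thesis
      by (rule tk.le_mono[OF tk.le_trans[OF 1 2]]) (use W sets.sets_into_space[of W M] in auto)
  qed
  define D where "D j = {x \<in> space M. infinite {n::nat. (x, int n) \<in> Q j}}" for j
  have D [measurable]: "D j \<in> sets M" for j
  proof -
    have "D j = {x \<in> space M. \<forall>m::nat. \<exists>n\<in>{m..}. (x, int n) \<in> Q j}"
      unfolding D_def infinite_nat_iff_unbounded_le by auto
    also have "\<dots> \<in> sets M"
      by (intro sets.sets_Collect_countable_All sets.sets_Collect_countable_Ex' section_sets Qs) auto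
    finally show ?thesis .
  qed
  have tr: "traveling (saturation (D j))" for j
    unfolding traveling_def
  proof (intro exI conjI ballI)
    show "tk.le (Q j) (space M \<times> {0})" by (rule Qle)
    show "\<exists>g\<in>carrier G. infinite {n::nat. (\<phi> g x, int n) \<in> Q j}" if "x \<in> saturation (D j)" for x
      using that by (simp add: saturation_def D_def) blast
  qed
  \<comment> \<open>Only slots below \<open>N\<close> occur; all naturals are allowed to fit
    \<open>traveling_UN\<close>. Points of one orbit may prefer different slots, which the
    saturation absorbs.\<close>
  have "W \<subseteq> (\<Union>k::nat. saturation (D (int k)))"
  proof
    fix x assume x: "x \<in> W"
    have "n \<in> (\<Union>j\<in>{0..<int N}. {n::nat. (x, int n) \<in> Q j})" for n
    proof -
      have "(x, int n) \<in> W \<times> {0..}" using x by simp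
      then have "token_act \<phi> (\<gamma> (x, int n)) (x, int n) \<in> tok W N" using \<gamma> unfolding tk.embeds_def by blast
      then show ?thesis using x by (auto simp: Q_def tok_def mem_Times_iff)
    qed
    then have "(\<Union>j\<in>{0..<int N}. {n::nat. (x, int n) \<in> Q j}) = UNIV" by blast
    then have "infinite (\<Union>j\<in>{0..<int N}. {n::nat. (x, int n) \<in> Q j})" by simp
    then obtain j where j: "j \<in> {0..<int N}" "infinite {n::nat. (x, int n) \<in> Q j}" by auto
    have "x \<in> D (int (nat j))" using x j W sets.sets_into_space[of W M] by (auto simp: D_def)
    then have "x \<in> saturation (D (int (nat j)))"
      using subset_saturation[of "D (int (nat j))"] by (auto simp: D_def)
    then show "x \<in> (\<Union>k::nat. saturation (D (int k)))" by blast
  qed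
  then show ?thesis
    by (rule traveling_mono[OF traveling_UN, rotated 2]) (auto intro: tr invariant_saturation D)
qed

text \<open>Layer \<open>N'\<close> of the tokens is left free by the embedding into
  \<open>tok W N'\<close>. Its iterated images are infinitely many disjoint copies of
  \<open>W\<close> inside \<open>tok W N\<close>; sending token layer \<open>n\<close> to the
  \<open>n\<close>-th copy brings all layers into \<open>N\<close> slots.\<close>

lemma compression_traveling:
  assumes W: "invariant W" and le: "tle W N W N'" and N: "N' < N"
  shows "traveling W"
proof -
  have "W \<in> sets M" using W by simp
  then have "\<exists>C :: nat \<Rightarrow> ('a \<times> int) set. disjoint_family C \<and> (\<forall>n. C n \<subseteq> tok W N \<and> tk.le (W \<times> {int N'}) (C n))"
    using le N unfolding tle_def by (intro tk.compression_orbit) (auto simp: tok_def)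
  then obtain C :: "nat \<Rightarrow> ('a \<times> int) set" where C: "disjoint_family C"
    "\<And>n. C n \<subseteq> tok W N" "\<And>n. tk.le (W \<times> {int N'}) (C n)" by blast
  have "tk.le (W \<times> {int n}) (C n)" for n
    using tk.le_trans[OF _ C(3)] le_shift[OF \<open>W \<in> sets M\<close>, of "{int n}" "int N' - int n"] by simp
  then have "tk.le (\<Union>n. W \<times> {int n}) (\<Union>n. C n)" using C(1) by (rule tk.le_UN)
  moreover have "(\<Union>n. W \<times> {int n}) = W \<times> {0..}"
    by (auto, metis nonneg_int_cases)
  moreover have "(\<Union>n. C n) \<subseteq> tok W N" using C(2) by blast
  ultimately show ?thesis using traveling_slots[OF W] tk.le_mono by metis
qed

text \<open>For positive denominators \<open>c\<close> says \<open>p/q + p'/q' < p''/q''\<close>.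
  Over the common denominator, copies of \<open>?W\<close> go into copies of
  \<open>A \<union> B\<close> by the lower bound, and back into fewer copies of \<open>?W\<close> by
  the two upper bounds.\<close>

lemma traveling_subadditive:
  assumes AB: "A \<in> sets M" "B \<in> sets M" and c: "q'' * (p * q' + p' * q) < p'' * (q * q')"
  shows "traveling (up A q p \<inter> up B q' p' \<inter> dn (A \<union> B) q'' p'')" (is "traveling ?W")
proof -
  have W: "invariant ?W" using AB by (intro invariant_Int invariant_up invariant_dn) auto
  note [simp] = sets.Int[OF _ invariant_sets[OF W]] invariant_sets[OF W]
  have 1: "tle (A \<inter> ?W) q ?W p" "tle (B \<inter> ?W) q' ?W p'" using AB W by (auto intro!: up_tle)
  have 2: "tle ?W p'' ((A \<union> B) \<inter> ?W) q''" using AB W by (intro dn_tle) auto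
  have "tle (A \<inter> ?W) (q * q') ?W (p * q')" "tle (B \<inter> ?W) (q * q') ?W (p' * q)"
    using tle_mult[OF 1(1), of q'] tle_mult[OF 1(2), of q] AB by (simp_all add: mult.commute)
  then have "tle (A \<inter> ?W \<union> B \<inter> ?W) (q * q') ?W (p * q' + p' * q)" by (rule tle_Un_left) simp
  then have "tle ((A \<union> B) \<inter> ?W) (q * q') ?W (p * q' + p' * q)" by (simp only: Int_Un_distrib2)
  then have 3: "tle ((A \<union> B) \<inter> ?W) (q'' * (q * q')) ?W (q'' * (p * q' + p' * q))"
    using AB by (intro tle_mult) auto
  have "tle ?W ((q * q') * p'') ((A \<union> B) \<inter> ?W) ((q * q') * q'')" using 2 AB by (intro tle_mult) auto
  then have "tle ?W ((q * q') * p'') ?W (q'' * (p * q' + p' * q))"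
    by (rule tle_trans[OF _ 3[unfolded mult.commute[of q'' "q * q'"]]])
  from compression_traveling[OF W this] c show ?thesis by (simp add: mult.commute)
qed

text \<open>Lower bounds add only over disjoint parts, hence \<open>B - A\<close>. With the trivial
  bound \<open>p' = 0\<close> this form also yields monotonicity of the content.\<close>

lemma traveling_superadditive:
  assumes AB: "A \<in> sets M" "B \<in> sets M" and c: "p'' * (q * q') < q'' * (p * q' + p' * q)"
  shows "traveling (dn A q p \<inter> dn (B - A) q' p' \<inter> up (A \<union> B) q'' p'')" (is "traveling ?W")
proof -
  have W: "invariant ?W" using AB by (intro invariant_Int invariant_up invariant_dn) auto
  note [simp] = sets.Int[OF _ invariant_sets[OF W]] invariant_sets[OF W]
  have 1: "tle ?W p (A \<inter> ?W) q" "tle ?W p' ((B - A) \<inter> ?W) q'" using AB W by (auto intro!: dn_tle)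
  have 2: "tle ((A \<union> B) \<inter> ?W) q'' ?W p''" using AB W by (intro up_tle) auto
  have "tle ?W (p * q') (A \<inter> ?W) (q * q')" "tle ?W (p' * q) ((B - A) \<inter> ?W) (q * q')"
    using tle_mult[OF 1(1), of q'] tle_mult[OF 1(2), of q] AB by (simp_all add: mult.commute)
  then have "tle ?W (p * q' + p' * q) (A \<inter> ?W \<union> (B - A) \<inter> ?W) (q * q')" by (rule tle_Un_right) auto
  moreover have "A \<inter> ?W \<union> (B - A) \<inter> ?W = (A \<union> B) \<inter> ?W" by blast
  ultimately have "tle ?W (p * q' + p' * q) ((A \<union> B) \<inter> ?W) (q * q')" by (simp only:)
  then have 3: "tle ?W (q'' * (p * q' + p' * q)) ((A \<union> B) \<inter> ?W) (q'' * (q * q'))"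
    using AB by (intro tle_mult) auto
  have "tle ((A \<union> B) \<inter> ?W) ((q * q') * q'') ?W ((q * q') * p'')" using 2 AB by (intro tle_mult) auto
  then have "tle ?W (q'' * (p * q' + p' * q)) ?W ((q * q') * p'')"
    by (rule tle_trans[OF 3[unfolded mult.commute[of q'' "q * q'"]]])
  from compression_traveling[OF W this] c show ?thesis by (simp add: mult.commute)
qed

text \<open>Translation embeds \<open>A\<close> into its image, so a lower bound for
  \<open>A\<close> passes to the image, where the smaller upper bound turns it into a
  compression.\<close>

lemma traveling_act_image:
  assumes A: "A \<in> sets M" and g: "g \<in> carrier G" and c: "p * q' < p' * q"
  shows "traveling (up (\<phi> g ` A) q p \<inter> dn A q' p')" (is "traveling ?W")
proof -
  have gA: "\<phi> g ` A \<in> sets M" by (rule act_image_sets[OF g A])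
  have W: "invariant ?W" using A gA by (intro invariant_Int invariant_up invariant_dn) auto
  note [simp] = sets.Int[OF _ invariant_sets[OF W]] invariant_sets[OF W]
  have 1: "tle (\<phi> g ` A \<inter> ?W) q ?W p" using gA W by (auto intro!: up_tle)
  have 2: "tle ?W p' (A \<inter> ?W) q'" using A W by (auto intro!: dn_tle)
  have "\<phi> g ` (A \<inter> ?W) \<subseteq> \<phi> g ` A \<inter> ?W" using W g unfolding invariant_def by blast
  then have "tle (\<phi> g ` (A \<inter> ?W)) q' (\<phi> g ` A \<inter> ?W) q'" using A g
    by (intro tle_subset act_image_sets) auto
  then have "tle (A \<inter> ?W) q' (\<phi> g ` A \<inter> ?W) q'"
    using tle_trans[OF tle_act_image[of "A \<inter> ?W" g q']] A g by simp
  then have "tle ?W p' (\<phi> g ` A \<inter> ?W) q'" using 2 tle_trans by blast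
  then have "tle ?W (q * p') (\<phi> g ` A \<inter> ?W) (q * q')" using gA by (intro tle_mult) auto
  moreover have "tle (\<phi> g ` A \<inter> ?W) (q' * q) ?W (q' * p)" using 1 gA by (intro tle_mult) auto
  ultimately have "tle ?W (q * p') ?W (q' * p)" unfolding mult.commute[of q' q] by (rule tle_trans)
  from compression_traveling[OF W this] c show ?thesis by (simp add: mult.commute)
qed

text \<open>Two copies of the space inside one copy of \<open>A\<close> is already a compression.
  Away from it, 2 bounds the content.\<close>

lemma traveling_dn_1_2:
  assumes A: "A \<in> sets M" shows "traveling (dn A 1 2)"
proof -
  have W: "invariant (dn A 1 2)" using A by (rule invariant_dn)
  have "tle (dn A 1 2) 2 (A \<inter> dn A 1 2) 1" using A W by (intro dn_tle) auto
  then have "tle (dn A 1 2) 2 (dn A 1 2) 1" by (rule tle_trans[OF _ tle_subset]) (use A W in auto)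
  then show ?thesis using W by (intro compression_traveling) auto
qed

end

context token_action
begin

text \<open>The alternative for a set \<open>K\<close> that fits arbitrarily often into the space: successively packing copies
  of \<open>K\<close> into the leftovers either never stops, or it shows that the space is covered by \<open>k + 1\<close>
  copies of \<open>K\<close>, which is a compression because \<open>k + 2\<close> copies of \<open>K\<close> fit into the space.\<close>

lemma traveling_small:
  assumes K: "K \<in> sets M"
  shows "traveling ((\<Inter>n. up K n 1) \<inter> saturation K)"
proof -
  define \<alpha> where "\<alpha> = K \<times> {0::int}"
  \<comment> \<open>\<open>V k\<close> is what the first \<open>k\<close> rounds of packing
    \<open>K\<close> leave free of the space.\<close>
  define V where "V = rec_nat (space M \<times> {0::int}) (\<lambda>_ v. tk.rest2 \<alpha> v)"
  have V: "V 0 = space M \<times> {0}" "V (Suc k) = tk.rest2 \<alpha> (V k)" for k by (simp_all add: V_def)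
  have \<alpha>: "\<alpha> \<in> sets TM" using K by (simp add: \<alpha>_def)
  have Vs: "V k \<in> sets TM" for k
  proof (induction k)
    case 0 then show ?case unfolding V by (rule Times_sets) simp
  qed (simp add: V tk.rest_sets \<alpha>)
  have dec: "V (Suc k) \<subseteq> V k" for k using tk.rest_subset[OF \<alpha> Vs] V by simp
  then have V0: "V k \<subseteq> V 0" for k by (induction k) blast+
  \<comment> \<open>On \<open>F1 k\<close> round \<open>k\<close> places all of \<open>K\<close>; on
    \<open>F2 k\<close> it uses up everything that was left of the space.\<close>
  define F1 F2 where "F1 k = tk.full1 \<alpha> (V k)" and "F2 k = tk.full2 \<alpha> (V k)" for k
  have F: "tk.invariant (F1 k)" "tk.invariant (F2 k)" "F1 k \<union> F2 k = space TM" for k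
    unfolding F1_def F2_def by (intro tk.invariant_full tk.full_Un \<alpha> Vs)+
  have Winf: "invariant (\<Inter>n. up K n 1)" by (intro invariant_INT invariant_up K)
  define T where "T = base (\<Inter>k. F1 k)"
  have T: "invariant T" "T \<times> UNIV = (\<Inter>k. F1 k)"
    unfolding T_def by (intro invariant_base base_Times tk.invariant_INT F)+
  have KT: "K \<inter> T \<in> sets M" by (rule sets.Int[OF K invariant_sets[OF T(1)]])
  have "traveling (T \<inter> saturation K)" unfolding traveling_def
  proof (intro exI conjI ballI)
    have "tk.le ((K \<inter> T) \<times> {int k}) (V k - V (Suc k))" for k
    proof -
      have sub: "(K \<inter> T) \<times> {0} \<subseteq> \<alpha> - tk.rest1 \<alpha> (V k)"
        using tk.full1_disjoint(1)[OF \<alpha> Vs[of k]] T(2) unfolding \<alpha>_def F1_def by blast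
      have "tk.le ((K \<inter> T) \<times> {0}) (V k - V (Suc k))"
        unfolding V by (rule tk.le_subset[OF tk.greedy_match(1)[OF \<alpha> Vs] Times_sets[OF KT] sub])
      moreover have "tk.le ((K \<inter> T) \<times> {int k}) ((K \<inter> T) \<times> {0})"
        using le_shift[OF KT, of "{int k}" "- int k"] by simp
      ultimately show ?thesis using tk.le_trans by blast
    qed
    then have "tk.le (\<Union>k. (K \<inter> T) \<times> {int k}) (\<Union>k. V k - V (Suc k))"
      by (intro tk.le_UN disjoint_family_diff_decseq dec)
    then show "tk.le (\<Union>k. (K \<inter> T) \<times> {int k}) (space M \<times> {0})"
      by (rule tk.le_mono) (use V0 V(1) in blast)
    fix x assume x: "x \<in> T \<inter> saturation K"
    then obtain g where g: "g \<in> carrier G" "\<phi> g x \<in> K" by (auto simp: saturation_def)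
    then have "\<phi> g x \<in> T" using T x by (auto simp: invariant_def)
    then have "{n. (\<phi> g x, int n) \<in> (\<Union>k. (K \<inter> T) \<times> {int k})} = UNIV" using g by auto
    then show "\<exists>g\<in>carrier G. infinite {n. (\<phi> g x, int n) \<in> (\<Union>k. (K \<inter> T) \<times> {int k})}"
      using g(1) by (metis infinite_UNIV_nat)
  qed
  moreover have "traveling (base (F2 k) \<inter> (\<Inter>n. up K n 1))" (is "traveling ?W") for k
  proof -
    have W: "invariant ?W" by (intro invariant_Int Winf invariant_base F)
    have WF: "?W \<times> UNIV \<subseteq> F2 k" using base_Times[OF F(2)[of k]] by blast
    have KW: "K \<inter> ?W \<in> sets M" by (rule sets.Int[OF K invariant_sets[OF W]])
    have Wsp: "?W \<subseteq> space M" by (auto simp: base_def)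
    have step: "tk.le ((V 0 - V j) \<inter> ?W \<times> UNIV) (tok (K \<inter> ?W) j)" for j
    proof (induction j)
      case 0 then show ?case by (auto simp: tok_def intro: tk.subset_imp_le)
    next
      case (Suc j)
      have "tk.le (V j - V (Suc j)) \<alpha>"
        unfolding V by (rule tk.le_mono[OF tk.greedy_match(2)[OF \<alpha> Vs]]) blast
      then have "tk.le ((V j - V (Suc j)) \<inter> ?W \<times> UNIV) (\<alpha> \<inter> ?W \<times> UNIV)"
        by (intro tk.le_Int_invariant invariant_Times W)
      also have "\<alpha> \<inter> ?W \<times> UNIV = (K \<inter> ?W) \<times> {0}" by (auto simp: \<alpha>_def)
      finally have "tk.le ((V j - V (Suc j)) \<inter> ?W \<times> UNIV) ((K \<inter> ?W) \<times> {int j})"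
        using tk.le_trans le_shift[OF KW, of "{0}" "int j"] by simp
      then have "tk.le ((V 0 - V j) \<inter> ?W \<times> UNIV \<union> (V j - V (Suc j)) \<inter> ?W \<times> UNIV)
          (tok (K \<inter> ?W) j \<union> (K \<inter> ?W) \<times> {int j})"
        by (intro tk.le_Un Suc.IH) (auto simp: tok_def)
      moreover have "(V 0 - V j) \<inter> ?W \<times> UNIV \<union> (V j - V (Suc j)) \<inter> ?W \<times> UNIV = (V 0 - V (Suc j)) \<inter> ?W \<times> UNIV"
        using V0[of j] dec[of j] by blast
      moreover have "tok (K \<inter> ?W) j \<union> (K \<inter> ?W) \<times> {int j} = tok (K \<inter> ?W) (Suc j)" by (auto simp: tok_def)
      ultimately show ?case by simp
    qed
    have "V (Suc k) \<inter> ?W \<times> UNIV = {}"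
      using tk.full1_disjoint(2)[OF \<alpha> Vs[of k]] WF unfolding V F2_def by blast
    then have "(V 0 - V (Suc k)) \<inter> ?W \<times> UNIV = tok ?W 1" using Wsp by (auto simp: V(1) tok_def)
    then have 1: "tle ?W 1 (K \<inter> ?W) (Suc k)" using step[of "Suc k"] by (simp add: tle_def)
    have 2: "tle (K \<inter> ?W) (Suc (Suc k)) ?W 1" by (rule up_tle[OF K W]) auto
    \<comment> \<open>Scaling the covering by \<open>k + 2\<close> and the packing by
      \<open>k + 1\<close> equalizes the multiples of \<open>K\<close> and puts \<open>k + 2\<close>
      copies of \<open>?W\<close> into \<open>k + 1\<close>.\<close>
    have "tle ?W (Suc (Suc k) * 1) (K \<inter> ?W) (Suc (Suc k) * Suc k)"
      by (rule tle_mult[OF 1 invariant_sets[OF W] KW])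
    moreover have "tle (K \<inter> ?W) (Suc k * Suc (Suc k)) ?W (Suc k * 1)"
      by (rule tle_mult[OF 2 KW invariant_sets[OF W]])
    ultimately have "tle ?W (Suc (Suc k) * 1) ?W (Suc k * 1)"
      unfolding mult.commute[of "Suc k" "Suc (Suc k)"] by (rule tle_trans)
    then show ?thesis by (rule compression_traveling[OF W]) simp
  qed
  \<comment> \<open>Index 0 stands for packing that never stops, index \<open>Suc k\<close> for the
    space running out in round \<open>k\<close>.\<close>
  ultimately have "traveling (case_nat (T \<inter> saturation K) (\<lambda>k. base (F2 k) \<inter> (\<Inter>n. up K n 1)) n)" for n
    by (cases n) simp_all
  moreover have "invariant (case_nat (T \<inter> saturation K) (\<lambda>k. base (F2 k) \<inter> (\<Inter>n. up K n 1)) n)" for n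
    by (cases n) (simp_all add: invariant_Int T Winf invariant_base F invariant_saturation K del: One_nat_def)
  ultimately have tr: "traveling (\<Union>n. case_nat (T \<inter> saturation K) (\<lambda>k. base (F2 k) \<inter> (\<Inter>n. up K n 1)) n)"
    by (rule traveling_UN)
  show ?thesis
  proof (rule traveling_mono[OF tr], rule subsetI)
    fix x assume x: "x \<in> (\<Inter>n. up K n 1) \<inter> saturation K"
    have xs: "x \<in> space M" using x by (simp add: saturation_def)
    show "x \<in> (\<Union>n. case_nat (T \<inter> saturation K) (\<lambda>k. base (F2 k) \<inter> (\<Inter>n. up K n 1)) n)"
    proof (cases "x \<in> T")
      case True then show ?thesis using x by (intro UN_I[of 0]) auto
    next
      case False
      then obtain k where "(x, 0) \<notin> F1 k" using xs by (auto simp: T_def base_def)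
      then have "x \<in> base (F2 k)" using F(3)[of k] xs by (auto simp: base_def)
      then show ?thesis using x by (intro UN_I[of "Suc k"]) auto
    qed
  qed
qed

text \<open>The failures for fixed \<open>A\<close>, \<open>B\<close> are indexed by naturals and
  group elements, hence countable in number, and \<open>traveling_countable_Union\<close> collects
  them. The intended instance is the pair of cylinders in the shift space.\<close>

lemma wandering_set_exists:
  assumes AB: "A \<in> sets M" "B \<in> sets M"
  obtains R where "invariant R" "traveling R"
    "\<And>p q p' q' p'' q''. q'' * (p * q' + p' * q) < p'' * (q * q') \<Longrightarrow> up A q p \<inter> up B q' p' \<inter> dn (A \<union> B) q'' p'' \<subseteq> R"
    "\<And>p q p' q' p'' q''. p'' * (q * q') < q'' * (p * q' + p' * q) \<Longrightarrow> dn A q p \<inter> dn (B - A) q' p' \<inter> up (A \<union> B) q'' p'' \<subseteq> R"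
    "\<And>g p q p' q'. g \<in> carrier G \<Longrightarrow> p * q' < p' * q \<Longrightarrow> up (\<phi> g ` A) q p \<inter> dn A q' p' \<subseteq> R"
    "dn A 1 2 \<subseteq> R" "(\<Inter>n. up A n 1) \<inter> saturation A \<subseteq> R"
proof -
  define I :: "(nat \<times> nat \<times> nat \<times> nat \<times> nat \<times> nat) set" where
    "I = {(p, q, p', q', p'', q''). q'' * (p * q' + p' * q) < p'' * (q * q')}"
  define J :: "(nat \<times> nat \<times> nat \<times> nat \<times> nat \<times> nat) set" where
    "J = {(p, q, p', q', p'', q''). p'' * (q * q') < q'' * (p * q' + p' * q)}"
  define L :: "('g \<times> nat \<times> nat \<times> nat \<times> nat) set" where
    "L = {(g, p, q, p', q'). g \<in> carrier G \<and> p * q' < p' * q}"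
  define WI where "WI = (\<lambda>(p, q, p', q', p'', q''). up A q p \<inter> up B q' p' \<inter> dn (A \<union> B) q'' p'') ` I"
  define WJ where "WJ = (\<lambda>(p, q, p', q', p'', q''). dn A q p \<inter> dn (B - A) q' p' \<inter> up (A \<union> B) q'' p'') ` J"
  define WL where "WL = (\<lambda>(g, p, q, p', q'). up (\<phi> g ` A) q p \<inter> dn A q' p') ` L"
  define \<W> where "\<W> = WI \<union> WJ \<union> WL \<union> {dn A 1 2, (\<Inter>n. up A n 1) \<inter> saturation A}"
  have "L \<subseteq> carrier G \<times> UNIV" by (auto simp: L_def)
  then have "countable L" using countable_carrier by (meson countable_SIGMA countable_subset countableI_type)
  then have c: "countable \<W>" unfolding \<W>_def WI_def WJ_def WL_def by (intro countable_Un countable_image) auto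
  have t: "traveling W" "invariant W" if "W \<in> \<W>" for W
  proof -
    from that consider "W \<in> WI" | "W \<in> WJ" | "W \<in> WL" | "W = dn A 1 2" | "W = (\<Inter>n. up A n 1) \<inter> saturation A"
      unfolding \<W>_def by blast
    then have "traveling W \<and> invariant W"
    proof cases
      case 1 then show ?thesis using AB traveling_subadditive
        by (auto simp: WI_def I_def intro!: invariant_Int invariant_up invariant_dn)
    next
      case 2 then show ?thesis using AB traveling_superadditive
        by (auto simp: WJ_def J_def intro!: invariant_Int invariant_up invariant_dn)
    next
      case 3 then show ?thesis using AB traveling_act_image
        by (auto simp: WL_def L_def intro!: invariant_Int invariant_up invariant_dn act_image_sets)
    next
      case 4 then show ?thesis using AB traveling_dn_1_2 invariant_dn by simp
    next
      case 5 then show ?thesis using AB traveling_small[OF AB(1)]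
        by (simp add: invariant_Int invariant_INT invariant_up invariant_saturation)
    qed
    then show "traveling W" "invariant W" by auto
  qed
  have sub: "WI \<subseteq> \<W>" "WJ \<subseteq> \<W>" "WL \<subseteq> \<W>" unfolding \<W>_def by blast+
  show thesis
  proof (rule that[of "\<Union>\<W>"])
    show "invariant (\<Union>\<W>)" using invariant_countable_Union c t by blast
    show "traveling (\<Union>\<W>)" using traveling_countable_Union c t by blast
    show "up A q p \<inter> up B q' p' \<inter> dn (A \<union> B) q'' p'' \<subseteq> \<Union>\<W>" if "q'' * (p * q' + p' * q) < p'' * (q * q')" for p q p' q' p'' q''
      by (rule Union_upper[OF subsetD[OF sub(1)]], unfold WI_def, rule image_eqI[of _ _ "(p, q, p', q', p'', q'')"])
        (use that in \<open>simp_all add: I_def\<close>)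
    show "dn A q p \<inter> dn (B - A) q' p' \<inter> up (A \<union> B) q'' p'' \<subseteq> \<Union>\<W>" if "p'' * (q * q') < q'' * (p * q' + p' * q)" for p q p' q' p'' q''
      by (rule Union_upper[OF subsetD[OF sub(2)]], unfold WJ_def, rule image_eqI[of _ _ "(p, q, p', q', p'', q'')"])
        (use that in \<open>simp_all add: J_def\<close>)
    show "up (\<phi> g ` A) q p \<inter> dn A q' p' \<subseteq> \<Union>\<W>" if "g \<in> carrier G" "p * q' < p' * q" for g p q p' q'
      by (rule Union_upper[OF subsetD[OF sub(3)]], unfold WL_def, rule image_eqI[of _ _ "(g, p, q, p', q')"])
        (use that in \<open>simp_all add: L_def\<close>)
  qed (auto simp: \<W>_def)
qed

end

section \<open>Shift space and itineraries\<close>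

text \<open>On tokens, \<open>f\<close> times the identity on copy numbers is equivariant, so the
  greedy matching, and with it \<open>up\<close> and \<open>dn\<close>, is decided by
  \<open>f x\<close>.\<close>

lemma up_dn_pullback:
  assumes M: "meas_action G M \<phi>" and N: "meas_action G N \<psi>"
    and f: "f \<in> space M \<rightarrow> space N"
    and eqv: "\<And>g x. g \<in> carrier G \<Longrightarrow> x \<in> space M \<Longrightarrow> f (\<phi> g x) = \<psi> g (f x)"
    and A: "A \<subseteq> space N" and x: "x \<in> space M"
  shows "x \<in> token_action.up G M \<phi> (f -` A \<inter> space M) q p \<longleftrightarrow> f x \<in> token_action.up G N \<psi> A q p"
    and "x \<in> token_action.dn G M \<phi> (f -` A \<inter> space M) q p \<longleftrightarrow> f x \<in> token_action.dn G N \<psi> A q p"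
proof -
  interpret M: token_action G M \<phi> using M by (rule token_actionI)
  interpret N: token_action G N \<psi> using N by (rule token_actionI)
  let ?f = "map_prod f (id :: int \<Rightarrow> int)"
  have v: "?f -` N.tok A q \<inter> space M.TM = M.tok (f -` A \<inter> space M) q"
    "?f -` N.tok (space N) p \<inter> space M.TM = M.tok (space M) p"
    using f by (auto simp: M.tok_def N.tok_def)
  have 1: "?f \<in> space M.TM \<rightarrow> space N.TM" using f by auto
  have 2: "?f (token_act \<phi> g z) = token_act \<psi> g (?f z)" if "g \<in> carrier M.H" "z \<in> space M.TM" for g z
    using that eqv by (auto simp: token_act_def)
  have 3: "N.tok A q \<subseteq> space N.TM" "N.tok (space N) p \<subseteq> space N.TM" using A by (auto simp: N.tok_def)
  have 4: "(x, 0) \<in> space M.TM" using x by simp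
  have fx: "f x \<in> space N" using f x by auto
  note * = full_pullback[OF M.tk.meas_action_axioms N.tk.meas_action_axioms 1 _ 3 4, unfolded v]
  show "x \<in> M.up (f -` A \<inter> space M) q p \<longleftrightarrow> f x \<in> N.up A q p"
    "x \<in> M.dn (f -` A \<inter> space M) q p \<longleftrightarrow> f x \<in> N.dn A q p"
    using *(1)[OF 2] *(2)[OF 2] x fx unfolding M.up_def N.up_def M.dn_def N.dn_def M.base_def N.base_def
    by simp_all
qed

definition shift_space :: "('g, 'm) monoid_scheme \<Rightarrow> ('g \<Rightarrow> bool \<times> bool) measure" where
  "shift_space G = (\<Pi>\<^sub>M g\<in>carrier G. count_space UNIV)"

text \<open>Multiplying the argument on the right gives a left action, and the one for which
  itineraries are equivariant.\<close>

definition shift_act :: "('g, 'm) monoid_scheme \<Rightarrow> 'g \<Rightarrow> ('g \<Rightarrow> bool \<times> bool) \<Rightarrow> 'g \<Rightarrow> bool \<times> bool" where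
  "shift_act G h s = (\<lambda>g\<in>carrier G. s (g \<otimes>\<^bsub>G\<^esub> h))"

definition itinerary ::
  "('g, 'm) monoid_scheme \<Rightarrow> ('g \<Rightarrow> 'a \<Rightarrow> 'a) \<Rightarrow> 'a set \<Rightarrow> 'a set \<Rightarrow> 'a \<Rightarrow> 'g \<Rightarrow> bool \<times> bool" where
  "itinerary G \<phi> A B x = (\<lambda>g\<in>carrier G. (\<phi> g x \<in> A, \<phi> g x \<in> B))"

text \<open>With \<open>cyl2\<close> the universal pair: their preimages under
  \<open>itinerary G \<phi> A B\<close> are \<open>A\<close> and \<open>B\<close>.\<close>

definition cyl1 :: "('g, 'm) monoid_scheme \<Rightarrow> ('g \<Rightarrow> bool \<times> bool) set" where
  "cyl1 G = {s \<in> space (shift_space G). fst (s \<one>\<^bsub>G\<^esub>)}"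

definition cyl2 :: "('g, 'm) monoid_scheme \<Rightarrow> ('g \<Rightarrow> bool \<times> bool) set" where
  "cyl2 G = {s \<in> space (shift_space G). snd (s \<one>\<^bsub>G\<^esub>)}"

lemma measurable_shift_space_eval [measurable]:
  "g \<in> carrier G \<Longrightarrow> (\<lambda>s. s g) \<in> measurable (shift_space G) (count_space UNIV)"
  unfolding shift_space_def by (rule measurable_component_singleton)

lemma meas_action_shift:
  assumes "group G" "countable (carrier G)"
  shows "meas_action G (shift_space G) (shift_act G)"
proof -
  interpret G: group G by fact
  show ?thesis
  proof (intro meas_action.intro meas_action_axioms.intro assms)
    show "shift_act G h \<in> measurable (shift_space G) (shift_space G)" if h: "h \<in> carrier G" for h
    proof -
      have "(\<lambda>s. \<lambda>g\<in>carrier G. s (g \<otimes>\<^bsub>G\<^esub> h)) \<in> measurable (shift_space G) (\<Pi>\<^sub>M g\<in>carrier G. count_space UNIV)"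
        using h by (intro measurable_restrict measurable_shift_space_eval) auto
      then show ?thesis by (simp add: shift_act_def[abs_def] shift_space_def)
    qed
    show "shift_act G \<one>\<^bsub>G\<^esub> s = s" if "s \<in> space (shift_space G)" for s
      using that by (auto simp: shift_act_def shift_space_def space_PiM PiE_def extensional_def fun_eq_iff)
    show "shift_act G (g \<otimes>\<^bsub>G\<^esub> h) s = shift_act G g (shift_act G h s)" if "g \<in> carrier G" "h \<in> carrier G" for g h s
      using that by (auto simp: shift_act_def fun_eq_iff G.m_assoc)
  qed
qed

lemma cyl_sets: "group G \<Longrightarrow> cyl1 G \<in> sets (shift_space G)" "group G \<Longrightarrow> cyl2 G \<in> sets (shift_space G)"
proof -
  assume "group G"
  then interpret G: group G .
  have "(\<lambda>s. s \<one>\<^bsub>G\<^esub>) \<in> measurable (shift_space G) (count_space UNIV)" by simp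
  from measurable_sets[OF this, of "{b. fst b}"] measurable_sets[OF this, of "{b. snd b}"]
  show "cyl1 G \<in> sets (shift_space G)" "cyl2 G \<in> sets (shift_space G)"
    by (simp_all add: cyl1_def cyl2_def vimage_def Int_def conj_commute)
qed

context meas_action
begin

lemma itinerary_measurable:
  assumes A[measurable]: "A \<in> sets M" and B[measurable]: "B \<in> sets M"
  shows "itinerary G \<phi> A B \<in> measurable M (shift_space G)"
proof -
  have "(\<lambda>x. \<lambda>g\<in>carrier G. (\<phi> g x \<in> A, \<phi> g x \<in> B)) \<in> measurable M (\<Pi>\<^sub>M g\<in>carrier G. count_space UNIV)"
  proof (rule measurable_restrict)
    fix g assume [simp]: "g \<in> carrier G"
    have [measurable]: "\<phi> g \<in> measurable M M" by simp
    have "(\<lambda>x. (\<phi> g x \<in> A, \<phi> g x \<in> B)) = (\<lambda>x. if \<phi> g x \<in> A then if \<phi> g x \<in> B then (True, True) else (True, False)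
        else if \<phi> g x \<in> B then (False, True) else (False, False))" by auto
    also have "\<dots> \<in> measurable M (count_space UNIV)" by measurable
    finally show "(\<lambda>x. (\<phi> g x \<in> A, \<phi> g x \<in> B)) \<in> measurable M (count_space UNIV)" .
  qed
  then show ?thesis by (simp add: itinerary_def[abs_def] shift_space_def)
qed

lemma itinerary_act:
  "h \<in> carrier G \<Longrightarrow> x \<in> space M \<Longrightarrow> itinerary G \<phi> A B (\<phi> h x) = shift_act G h (itinerary G \<phi> A B x)"
  by (auto simp: itinerary_def shift_act_def fun_eq_iff act_mult)

lemma itinerary_space: "itinerary G \<phi> A B x \<in> space (shift_space G)"
  by (auto simp: itinerary_def shift_space_def space_PiM)

lemma itinerary_cyl:
  assumes "x \<in> space M"
  shows "itinerary G \<phi> A B x \<in> cyl1 G \<longleftrightarrow> x \<in> A" "itinerary G \<phi> A B x \<in> cyl2 G \<longleftrightarrow> x \<in> B"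
  using assms itinerary_space by (auto simp: cyl1_def cyl2_def itinerary_def)

end

section \<open>Measures from contents on open sets\<close>

text \<open>The family \<open>\<O>\<close> interpolates between compact and open sets. This lets a
  countable family of open sets determine a measure on all Borel sets.\<close>

locale open_content =
  fixes T :: "'a topology" and \<O> :: "'a set set" and m :: "'a set \<Rightarrow> real" and c :: real
  assumes Hausdorff: "Hausdorff_space T"
    and open_O: "U \<in> \<O> \<Longrightarrow> openin T U"
    and separates: "\<lbrakk>compactin T C; openin T V; C \<subseteq> V\<rbrakk> \<Longrightarrow> \<exists>U\<in>\<O>. C \<subseteq> U \<and> U \<subseteq> V"
    and Un_O: "\<lbrakk>U \<in> \<O>; V \<in> \<O>\<rbrakk> \<Longrightarrow> U \<union> V \<in> \<O>"
    and m_nonneg: "U \<in> \<O> \<Longrightarrow> 0 \<le> m U"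
    and m_le: "U \<in> \<O> \<Longrightarrow> m U \<le> c"
    and m_mono: "\<lbrakk>U \<in> \<O>; V \<in> \<O>; U \<subseteq> V\<rbrakk> \<Longrightarrow> m U \<le> m V"
    and m_subadd: "\<lbrakk>U \<in> \<O>; V \<in> \<O>\<rbrakk> \<Longrightarrow> m (U \<union> V) \<le> m U + m V"
    and m_superadd: "\<lbrakk>U \<in> \<O>; V \<in> \<O>; U \<inter> V = {}\<rbrakk> \<Longrightarrow> m U + m V \<le> m (U \<union> V)"
begin

text \<open>Regularization of \<open>m\<close> on compact sets from outside. The measure is built
  from \<open>lam\<close> alone.\<close>

definition lam :: "'a set \<Rightarrow> real" where
  "lam C = Inf (m ` {U \<in> \<O>. C \<subseteq> U})"

lemma lam_le: "\<lbrakk>U \<in> \<O>; C \<subseteq> U\<rbrakk> \<Longrightarrow> lam C \<le> m U"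
  unfolding lam_def by (rule cInf_lower) (auto intro!: bdd_belowI[of _ 0] m_nonneg)

lemma lam_nonempty: "compactin T C \<Longrightarrow> {U \<in> \<O>. C \<subseteq> U} \<noteq> {}"
  using separates[of C "topspace T"] compactin_subset_topspace by blast

lemma lam_ge: "\<lbrakk>compactin T C; \<And>U. U \<in> \<O> \<Longrightarrow> C \<subseteq> U \<Longrightarrow> r \<le> m U\<rbrakk> \<Longrightarrow> r \<le> lam C"
  unfolding lam_def using lam_nonempty by (intro cInf_greatest) auto

lemma lam_approx:
  assumes "compactin T C" "0 < e"
  obtains U where "U \<in> \<O>" "C \<subseteq> U" "m U < lam C + e"
proof -
  have "\<exists>r\<in>m ` {U \<in> \<O>. C \<subseteq> U}. r < lam C + e"
    unfolding lam_def using lam_nonempty[OF assms(1)] assms(2) by (intro cInf_lessD) auto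
  then show thesis using that by blast
qed

lemma lam_nonneg: "compactin T C \<Longrightarrow> 0 \<le> lam C"
  by (rule lam_ge) (auto intro: m_nonneg)

lemma lam_le_c:
  assumes "compactin T C" shows "lam C \<le> c"
proof -
  obtain U where "U \<in> \<O>" "C \<subseteq> U" using lam_nonempty[OF assms] by blast
  then show ?thesis using lam_le m_le by (meson order_trans)
qed

lemma lam_mono: "\<lbrakk>compactin T D; C \<subseteq> D\<rbrakk> \<Longrightarrow> lam C \<le> lam D"
  by (rule lam_ge) (auto intro: lam_le)

text \<open>The Hausdorff property separates the two compact sets; members of \<open>\<O>\<close>
  squeezed into the separating sets and into \<open>W\<close> are disjoint, so superadditivity of
  \<open>m\<close> applies.\<close>

lemma lam_disjoint:
  assumes C: "compactin T C" and D: "compactin T D" and disj: "C \<inter> D = {}"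
  shows "lam C + lam D \<le> lam (C \<union> D)"
proof (rule lam_ge)
  show "compactin T (C \<union> D)" using C D by (rule compactin_Un)
  fix W assume W: "W \<in> \<O>" "C \<union> D \<subseteq> W"
  obtain U V where UV: "openin T U" "openin T V" "C \<subseteq> U" "D \<subseteq> V" "disjnt U V"
    using Hausdorff_space_compact_separation[OF Hausdorff C D] disj by (auto simp: disjnt_def)
  obtain U' where U': "U' \<in> \<O>" "C \<subseteq> U'" "U' \<subseteq> U \<inter> W"
    using separates[OF C openin_Int[OF UV(1) open_O[OF W(1)]]] UV W by auto
  obtain V' where V': "V' \<in> \<O>" "D \<subseteq> V'" "V' \<subseteq> V \<inter> W"
    using separates[OF D openin_Int[OF UV(2) open_O[OF W(1)]]] UV W by auto
  have "lam C + lam D \<le> m U' + m V'" using U' V' lam_le by (meson add_mono)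
  also have "\<dots> \<le> m (U' \<union> V')" using U' V' UV by (intro m_superadd) (auto simp: disjnt_def)
  also have "\<dots> \<le> m W" using U' V' W by (intro m_mono Un_O) auto
  finally show "lam C + lam D \<le> m W" .
qed

lemma lam_empty: "lam {} = 0"
  using lam_disjoint[of "{}" "{}"] lam_nonneg[of "{}"] by simp

text \<open>Inner approximation of differences; this is what makes the set function \<open>inner_content\<close> below additive,
  without any regularity of the topology beyond the Hausdorff property.\<close>

lemma lam_tight:
  assumes C: "compactin T C" and C': "compactin T C'" "C' \<subseteq> C" and e: "0 < e"
  obtains D where "compactin T D" "D \<subseteq> C - C'" "lam C \<le> lam C' + lam D + e"
proof -
  obtain U where U: "U \<in> \<O>" "C' \<subseteq> U" "m U < lam C' + e" using lam_approx[OF C'(1) e] by blast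
  have "closedin T (topspace T - U)" using open_O[OF U(1)] by blast
  moreover have "(topspace T - U) \<inter> C = C - U" using compactin_subset_topspace[OF C] by blast
  ultimately have D: "compactin T (C - U)" using closed_Int_compactin[OF _ C] by metis
  have "lam C - m U \<le> lam (C - U)"
  proof (rule lam_ge[OF D])
    fix V assume V: "V \<in> \<O>" "C - U \<subseteq> V"
    have "lam C \<le> m (U \<union> V)" using U V by (intro lam_le Un_O) auto
    also have "\<dots> \<le> m U + m V" using U V by (intro m_subadd)
    finally show "lam C - m U \<le> m V" by simp
  qed
  then have "lam C \<le> lam C' + lam (C - U) + e" using U(3) by simp
  moreover have "C - U \<subseteq> C - C'" using U(2) by blast
  ultimately show thesis using that[OF D] by blast
qed

section \<open>The inner content and its extension to a Borel measure\<close>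

definition inner_content :: "'a set \<Rightarrow> ennreal" where
  "inner_content E = (SUP C\<in>{C. compactin T C \<and> C \<subseteq> E}. ennreal (lam C))"

lemma inner_upper: "\<lbrakk>compactin T C; C \<subseteq> E\<rbrakk> \<Longrightarrow> ennreal (lam C) \<le> inner_content E"
  unfolding inner_content_def by (rule SUP_upper) auto

lemma inner_compact: "compactin T C \<Longrightarrow> inner_content C = ennreal (lam C)"
  by (intro antisym inner_upper order_refl) (auto simp: inner_content_def intro!: SUP_least ennreal_leI lam_mono)

lemma inner_le: "inner_content E \<le> ennreal c"
  unfolding inner_content_def by (auto intro!: SUP_least ennreal_leI lam_le_c)

lemma inner_empty: "inner_content {} = 0"
  using inner_compact[of "{}"] by (simp add: lam_empty)

lemma inner_mono: "E \<subseteq> F \<Longrightarrow> inner_content E \<le> inner_content F"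
  unfolding inner_content_def by (rule SUP_subset_mono) auto

sublocale sub: sigma_algebra "topspace T" "Pow (topspace T)"
  by (rule sigma_algebra_Pow)

text \<open>Caratheodory's splitting condition, but for a set function built from inside. It gives
  an algebra with finite additivity; countable additivity has to come from
  \<open>inner_continuous\<close>.\<close>

definition split_sets :: "'a set set" where
  "split_sets = lambda_system (topspace T) (Pow (topspace T)) inner_content"

lemma positive_inner: "positive (Pow (topspace T)) inner_content"
  by (simp add: positive_def inner_empty)

sublocale spl: algebra "topspace T" split_sets
  unfolding split_sets_def by (rule sub.lambda_system_algebra[OF positive_inner])

text \<open>One inequality adds compact sets inside and outside \<open>F\<close> by
  \<open>lam_disjoint\<close>; for the other, a compact \<open>C\<close> is cut along the compact
  set \<open>C \<inter> F\<close> by \<open>lam_tight\<close>.\<close>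

lemma closedin_split_sets:
  assumes F: "closedin T F" shows "F \<in> split_sets"
proof -
  have "inner_content (E \<inter> F) + inner_content (E - F) = inner_content E" for E
  proof (rule antisym)
    have ne: "{C. compactin T C \<and> C \<subseteq> S} \<noteq> {}" for S by auto
    show "inner_content (E \<inter> F) + inner_content (E - F) \<le> inner_content E"
      unfolding inner_content_def[of "E \<inter> F"] inner_content_def[of "E - F"]
      unfolding ennreal_SUP_add_left[OF ne, symmetric]
      unfolding ennreal_SUP_add_right[OF ne]
    proof (intro SUP_least)
      fix C D assume C: "C \<in> {C. compactin T C \<and> C \<subseteq> E \<inter> F}" and D: "D \<in> {D. compactin T D \<and> D \<subseteq> E - F}"
      have "ennreal (lam C) + ennreal (lam D) = ennreal (lam C + lam D)"
        using C D by (simp add: lam_nonneg)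
      also have "\<dots> \<le> ennreal (lam (C \<union> D))" using C D by (intro ennreal_leI lam_disjoint) auto
      also have "\<dots> \<le> inner_content E" using C D by (intro inner_upper compactin_Un) auto
      finally show "ennreal (lam C) + ennreal (lam D) \<le> inner_content E" .
    qed
    show "inner_content E \<le> inner_content (E \<inter> F) + inner_content (E - F)"
      unfolding inner_content_def[of E]
    proof (rule SUP_least, rule ennreal_le_epsilon)
      fix C and e :: real assume C: "C \<in> {C. compactin T C \<and> C \<subseteq> E}" and e: "0 < e"
      have C': "compactin T C" "C \<subseteq> E" using C by auto
      have CF: "compactin T (C \<inter> F)" using closed_Int_compactin[OF F C'(1)] by (simp add: Int_commute)
      obtain D where D: "compactin T D" "D \<subseteq> C - C \<inter> F" "lam C \<le> lam (C \<inter> F) + lam D + e"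
        using lam_tight[OF C'(1) CF Int_lower1 e] by blast
      have "ennreal (lam C) \<le> ennreal (lam (C \<inter> F)) + ennreal (lam D) + ennreal e"
        using D(3) e lam_nonneg[OF CF] lam_nonneg[OF D(1)] by (simp flip: ennreal_plus add: ennreal_leI)
      also have "\<dots> \<le> inner_content (E \<inter> F) + inner_content (E - F) + ennreal e"
        using C' CF D by (intro add_mono inner_upper order_refl) blast+
      finally show "ennreal (lam C) \<le> inner_content (E \<inter> F) + inner_content (E - F) + ennreal e" .
    qed
  qed
  then show ?thesis using closedin_subset[OF F] by (simp add: split_sets_def sub.lambda_system_eq)
qed

lemma inner_additive: "additive split_sets inner_content"
  unfolding split_sets_def by (rule sub.lambda_system_additive)

lemma inner_positive_split: "positive split_sets inner_content"
  by (simp add: positive_def inner_empty)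

lemma inner_approx:
  assumes "0 < e" obtains C where "compactin T C" "C \<subseteq> E" "inner_content E \<le> ennreal (lam C) + ennreal e"
proof -
  have "inner_content E \<noteq> \<infinity>" using inner_le[of E] by (auto simp: top_unique)
  then have "\<exists>C\<in>{C. compactin T C \<and> C \<subseteq> E}. inner_content E < ennreal (lam C) + ennreal e"
    using assms by (intro SUP_approx_ennreal) (auto simp: inner_content_def)
  then show thesis using that less_imp_le by blast
qed

text \<open>Choose compact \<open>C i\<close> inside \<open>A i\<close> with error
  \<open>e / 2^(i+1)\<close>. They have empty intersection, so by compactness finitely many already
  do; then late \<open>A k\<close> are covered by the gaps \<open>A i - C i\<close>, of total
  content below \<open>e\<close>.\<close>

lemma inner_continuous:
  assumes A: "range A \<subseteq> split_sets" "decseq A" "(\<Inter>i::nat. A i) = {}"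
  shows "(\<lambda>i. inner_content (A i)) \<longlonglongrightarrow> 0"
proof (rule order_tendstoI)
  fix r :: ennreal assume r: "0 < r"
  obtain s where s: "0 < s" "s < r" using r dense by blast
  define e where "e = enn2real s"
  have e: "0 < e" "ennreal e < r"
  proof -
    have "s < \<infinity>" using s(2) by (rule less_le_trans) simp
    then show "0 < e" "ennreal e < r" using s by (simp_all add: e_def enn2real_positive_iff)
  qed
  have "\<exists>C. compactin T C \<and> C \<subseteq> A i \<and> inner_content (A i) \<le> ennreal (lam C) + ennreal (e * (1/2) ^ Suc i)" for i
    by (rule inner_approx[of "e * (1/2) ^ Suc i" "A i"]) (use e in auto)
  then obtain C where C: "\<And>i. compactin T (C i)" "\<And>i. C i \<subseteq> A i"
    "\<And>i. inner_content (A i) \<le> ennreal (lam (C i)) + ennreal (e * (1/2) ^ Suc i)" by metis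
  have cl: "closedin T (C i)" for i using compactin_imp_closedin[OF Hausdorff C(1)] .
  have Cs: "C i \<in> split_sets" "A i \<in> split_sets" for i using closedin_split_sets[OF cl] A by auto
  have d: "inner_content (A i - C i) \<le> ennreal (e * (1/2) ^ Suc i)" for i
  proof -
    have "inner_content (A i) = inner_content (C i \<union> (A i - C i))" using C(2)[of i] by (simp add: Un_absorb1)
    also have "\<dots> = inner_content (C i) + inner_content (A i - C i)"
      by (rule additiveD[OF inner_additive]) (use Cs in auto)
    finally have "ennreal (lam (C i)) + inner_content (A i - C i) \<le> ennreal (lam (C i)) + ennreal (e * (1/2) ^ Suc i)"
      using C(3)[of i] inner_compact[OF C(1)] by simp
    then show ?thesis by (simp add: ennreal_add_left_cancel_le)
  qed
  have "\<exists>n. (\<Inter>i\<le>n. C i) = {}"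
  proof (rule ccontr)
    assume ne: "\<nexists>n. (\<Inter>i\<le>n. C i) = {}"
    \<comment> \<open>Finite intersection property inside the compact set
      \<open>C 0\<close>.\<close>
    have "C 0 \<inter> \<Inter>(range C) \<noteq> {}"
    proof -
      have "C 0 \<inter> \<Inter>\<F> \<noteq> {}" if f: "finite \<F>" "\<F> \<subseteq> range C" for \<F>
      proof -
        obtain J where J: "finite J" "\<F> = C ` J" using finite_subset_image[OF f] by auto
        obtain n where n: "J \<subseteq> {..n}" using J(1) finite_nat_iff_bounded_le by auto
        have "(\<Inter>i\<le>n. C i) \<subseteq> C 0 \<inter> \<Inter>\<F>" using n J by auto
        then show ?thesis using ne by blast
      qed
      moreover have "\<forall>D\<in>range C. closedin T D" using cl by blast
      ultimately show ?thesis
        using C(1)[of 0, unfolded compactin_fip, THEN conjunct2, THEN spec, of "range C"] by metis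
    qed
    moreover have "\<Inter>(range C) \<subseteq> (\<Inter>i. A i)" using C(2) by blast
    ultimately show False unfolding A(3) by simp
  qed
  then obtain n where n: "(\<Inter>i\<le>n. C i) = {}" by blast
  have "inner_content (A k) < r" if "n \<le> k" for k
  proof -
    have "A k \<subseteq> (\<Union>i\<in>{..n}. A i - C i)"
    proof
      fix x assume x: "x \<in> A k"
      have "x \<notin> (\<Inter>i\<le>n. C i)" unfolding n by simp
      then obtain i where i: "i \<le> n" "x \<notin> C i" by auto
      have "A k \<subseteq> A i" using decseqD[OF A(2), of i k] i(1) that by simp
      then have "x \<in> A i" using x by blast
      then show "x \<in> (\<Union>i\<in>{..n}. A i - C i)" using i by blast
    qed
    then have "inner_content (A k) \<le> inner_content (\<Union>i\<in>{..n}. A i - C i)" by (rule inner_mono)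
    also have "\<dots> \<le> (\<Sum>i\<in>{..n}. inner_content (A i - C i))"
      using Cs by (intro spl.subadditive inner_positive_split inner_additive) auto
    also have "\<dots> \<le> (\<Sum>i\<in>{..n}. ennreal (e * (1/2) ^ Suc i))" by (intro sum_mono d)
    also have "\<dots> = ennreal (\<Sum>i\<in>{..n}. e * (1/2) ^ Suc i)" using e by (intro sum_ennreal) auto
    also have "(\<Sum>i\<in>{..n}. e * (1/2) ^ Suc i) = e * (1 - (1/2) ^ Suc n)"
      by (induction n) (simp_all add: field_simps)
    also have "ennreal (e * (1 - (1/2) ^ Suc n)) \<le> ennreal e" using e by (intro ennreal_leI) (simp add: field_simps)
    also have "\<dots> < r" by (rule e)
    finally show ?thesis .
  qed
  then show "\<forall>\<^sub>F i in sequentially. inner_content (A i) < r" unfolding eventually_sequentially by blast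
qed simp

lemma open_sets_subset: "sigma_sets (topspace T) {U. openin T U} \<subseteq> sigma_sets (topspace T) split_sets"
proof (rule sigma_sets_mono, rule subsetI)
  fix U assume "U \<in> {U. openin T U}"
  then have "topspace T - (topspace T - U) \<in> split_sets"
    by (intro spl.compl_sets closedin_split_sets) auto
  moreover have "topspace T - (topspace T - U) = U" using \<open>U \<in> {U. openin T U}\<close> openin_subset by blast
  ultimately show "U \<in> sigma_sets (topspace T) split_sets" by auto
qed

text \<open>The Caratheodory extension is restricted from the sigma-algebra of split sets to the
  Borel sets. Values on closed sets are recorded because these form an intersection-stable
  generator.\<close>

lemma borel_measure_exists:
  obtains \<mu> where "sets \<mu> = sets (borel_of T)" "\<And>F. closedin T F \<Longrightarrow> emeasure \<mu> F = inner_content F"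
proof -
  have "\<exists>\<mu>. (\<forall>s \<in> split_sets. \<mu> s = inner_content s) \<and> measure_space (topspace T) (sigma_sets (topspace T) split_sets) \<mu>"
  proof (rule spl.caratheodory_empty_continuous[OF inner_positive_split inner_additive _ inner_continuous])
    show "inner_content A \<noteq> \<infinity>" for A using inner_le[of A] by (auto simp: top_unique)
  qed
  then obtain \<nu> where \<nu>: "\<And>s. s \<in> split_sets \<Longrightarrow> \<nu> s = inner_content s"
    "measure_space (topspace T) (sigma_sets (topspace T) split_sets) \<nu>" by blast
  define S where "S = sigma_sets (topspace T) {U. openin T U}"
  have sa: "sigma_algebra (topspace T) S" unfolding S_def
    by (rule sigma_algebra_sigma_sets) (auto dest: openin_subset)
  have ms: "measure_space (topspace T) S \<nu>"
    using measure_down[OF \<nu>(2) sa] open_sets_subset by (simp add: S_def)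
  show thesis
  proof (rule that)
    have op: "{U. openin T U} \<subseteq> Pow (topspace T)" by (auto dest: openin_subset)
    show 1: "sets (measure_of (topspace T) S \<nu>) = sets (borel_of T)"
      using sa op by (simp add: borel_of_def S_def sigma_algebra.sets_measure_of_eq)
    fix F assume F: "closedin T F"
    have "topspace T - (topspace T - F) \<in> S"
      using F unfolding S_def by (intro sigma_sets.Compl sigma_sets.Basic) auto
    moreover have "topspace T - (topspace T - F) = F" using closedin_subset[OF F] by blast
    ultimately show "emeasure (measure_of (topspace T) S \<nu>) F = inner_content F"
      using emeasure_measure_of_sigma[OF sa, of \<nu> F] ms \<nu>(1) closedin_split_sets[OF F]
      by (simp add: measure_space_def)
  qed
qed

text \<open>If a member of \<open>\<O>\<close> covers the image of \<open>C\<close> under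
  \<open>h\<close>, its image under \<open>h'\<close> covers \<open>C\<close> and has no larger
  value.\<close>

lemma inner_image_le:
  assumes h: "continuous_map T T h" "continuous_map T T h'" "\<And>x. x \<in> topspace T \<Longrightarrow> h' (h x) = x"
    and m: "\<And>U. U \<in> \<O> \<Longrightarrow> h' ` U \<in> \<O> \<and> m (h' ` U) \<le> m U" and E: "E \<subseteq> topspace T"
  shows "inner_content E \<le> inner_content (h ` E)"
  unfolding inner_content_def[of E]
proof (rule SUP_least)
  fix C assume C: "C \<in> {C. compactin T C \<and> C \<subseteq> E}"
  have hC: "compactin T (h ` C)" using C h image_compactin by blast
  have "lam C \<le> lam (h ` C)"
  proof (rule lam_ge[OF hC])
    fix U assume U: "U \<in> \<O>" "h ` C \<subseteq> U"
    have "C \<subseteq> h' ` U" using U h(3) C E by force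
    then show "lam C \<le> m U" using m[OF U(1)] lam_le by (meson order_trans)
  qed
  then have "ennreal (lam C) \<le> ennreal (lam (h ` C))" by (rule ennreal_leI)
  also have "\<dots> \<le> inner_content (h ` E)" using C hC by (intro inner_upper) auto
  finally show "ennreal (lam C) \<le> inner_content (h ` E)" .
qed

text \<open>The positivity assumption at a single compact set is what prevents the content from escaping to
  infinity.\<close>

theorem invariant_measure_exists:
  fixes h :: "'i \<Rightarrow> 'a \<Rightarrow> 'a"
  assumes h: "\<And>i. i \<in> I \<Longrightarrow> continuous_map T T (h i)"
    and inv: "\<And>i. i \<in> I \<Longrightarrow> \<exists>j\<in>I. \<forall>x\<in>topspace T. h j (h i x) = x \<and> h i (h j x) = x"
    and m: "\<And>i U. i \<in> I \<Longrightarrow> U \<in> \<O> \<Longrightarrow> h i ` U \<in> \<O> \<and> m (h i ` U) \<le> m U"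
    and K: "compactin T K" "0 < e" "\<And>U. U \<in> \<O> \<Longrightarrow> K \<subseteq> U \<Longrightarrow> e \<le> m U"
  shows "\<exists>\<mu>. sets \<mu> = sets (borel_of T) \<and> prob_space \<mu> \<and>
    (\<forall>i\<in>I. \<forall>A\<in>sets (borel_of T). emeasure \<mu> (h i ` A) = emeasure \<mu> A)"
proof -
  obtain \<mu> where \<mu>: "sets \<mu> = sets (borel_of T)" "\<And>F. closedin T F \<Longrightarrow> emeasure \<mu> F = inner_content F"
    using borel_measure_exists by blast
  have op: "{U. openin T U} \<subseteq> Pow (topspace T)" by (auto dest: openin_subset)
  have sets\<mu>: "sets \<mu> = sigma_sets (topspace T) {U. openin T U}" using \<mu>(1) op by (simp add: borel_of_def)
  have sp: "space \<mu> = topspace T" using \<mu>(1) sets_eq_imp_space_eq[OF \<mu>(1)] op by (simp add: borel_of_def space_measure_of)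
  have fin: "emeasure \<mu> (topspace T) \<noteq> \<infinity>" using \<mu>(2) inner_le[of "topspace T"] by (auto simp: top_unique)
  have "ennreal e \<le> emeasure \<mu> (topspace T)"
  proof -
    have "e \<le> lam K" using lam_ge[OF K(1)] K(3) by blast
    then have "ennreal e \<le> ennreal (lam K)" by (rule ennreal_leI)
    also have "\<dots> \<le> inner_content (topspace T)" using K compactin_subset_topspace by (intro inner_upper) auto
    finally show ?thesis using \<mu>(2) by simp
  qed
  then have pos: "emeasure \<mu> (topspace T) \<noteq> 0" using K(2) by auto
  have inv\<mu>: "emeasure \<mu> (h i ` A) = emeasure \<mu> A" if i: "i \<in> I" and A: "A \<in> sets \<mu>" for i A
  proof -
    obtain j where j: "j \<in> I" "\<And>x. x \<in> topspace T \<Longrightarrow> h j (h i x) = x" "\<And>x. x \<in> topspace T \<Longrightarrow> h i (h j x) = x"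
      using inv[OF i] by blast
    have hs: "h k x \<in> topspace T" if "k \<in> I" "x \<in> topspace T" for k x
      using h[OF that(1)] that(2) by (auto simp: continuous_map_def)
    have im: "h i ` B = h j -` B \<inter> topspace T" if "B \<subseteq> topspace T" for B
      using that j hs[OF i] hs[OF j(1)] by (auto intro!: rev_image_eqI)
    have meas: "h j \<in> measurable \<mu> \<mu>"
      unfolding measurable_def
    proof (intro CollectI conjI ballI)
      fix B assume "B \<in> sets \<mu>"
      then show "h j -` B \<inter> space \<mu> \<in> sets \<mu>" unfolding sets\<mu> sp
      proof (induction rule: sigma_sets.induct)
        case (Basic a)
        then have "openin T {x \<in> topspace T. h j x \<in> a}"
          using h[OF j(1)] by (auto simp: continuous_map_def)
        then show ?case by (auto simp: vimage_def Int_def conj_commute)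
      next
        case (Compl a)
        have "h j -` (topspace T - a) \<inter> topspace T = topspace T - (h j -` a \<inter> topspace T)"
          using hs[OF j(1)] by auto
        then show ?case using sigma_sets.Compl[OF Compl.IH] by simp
      next
        case (Union a)
        have "h j -` (\<Union>n. a n) \<inter> topspace T = (\<Union>n. h j -` a n \<inter> topspace T)" by auto
        then show ?case using sigma_sets.Union[OF Union.IH] by simp
      qed (auto intro: sigma_sets.Empty)
    qed (use hs[OF j(1)] sp in auto)
    have clE: "sets \<mu> = sigma_sets (topspace T) {F. closedin T F}"
      unfolding sets\<mu>
    proof (rule sigma_sets_eqI)
      fix U assume "U \<in> {U. openin T U}"
      then have "topspace T - (topspace T - U) \<in> sigma_sets (topspace T) {F. closedin T F}"
        by (intro sigma_sets.Compl sigma_sets.Basic) auto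
      then show "U \<in> sigma_sets (topspace T) {F. closedin T F}"
        using \<open>U \<in> {U. openin T U}\<close> openin_subset by (metis Diff_Diff_Int Int_absorb1 mem_Collect_eq)
    next
      fix F assume "F \<in> {F. closedin T F}"
      then have "topspace T - (topspace T - F) \<in> sigma_sets (topspace T) {U. openin T U}"
        by (intro sigma_sets.Compl sigma_sets.Basic) auto
      then show "F \<in> sigma_sets (topspace T) {U. openin T U}"
        using \<open>F \<in> {F. closedin T F}\<close> closedin_subset by (metis Diff_Diff_Int Int_absorb1 mem_Collect_eq)
    qed
    \<comment> \<open>Both measures are finite, so agreement on closed sets suffices; there
      \<open>\<mu>\<close> is the inner content.\<close>
    have "distr \<mu> \<mu> (h j) = \<mu>"
    proof (rule measure_eqI_generator_eq[where E = "{F. closedin T F}" and \<Omega> = "topspace T" and A = "\<lambda>_. topspace T"])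
      show "Int_stable {F. closedin T F}" by (auto simp: Int_stable_def)
      show "{F. closedin T F} \<subseteq> Pow (topspace T)" by (auto dest: closedin_subset)
      fix F assume "F \<in> {F. closedin T F}"
      then have F: "closedin T F" "F \<subseteq> topspace T" by (auto dest: closedin_subset)
      have hF: "closedin T (h i ` F)"
        using closedin_continuous_map_preimage[OF h[OF j(1)] F(1)] im[OF F(2)]
        by (simp add: vimage_def Int_def conj_commute)
      have "F \<in> sets \<mu>" using F clE by auto
      then have "emeasure (distr \<mu> \<mu> (h j)) F = emeasure \<mu> (h i ` F)"
        using meas im[OF F(2)] sp by (simp add: emeasure_distr)
      also have "\<dots> = inner_content (h i ` F)" by (rule \<mu>(2)[OF hF])
      \<comment> \<open>One inequality is \<open>inner_image_le\<close> for \<open>h i\<close>, the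
        other is the same for its inverse \<open>h j\<close>.\<close>
      also have "\<dots> = inner_content F"
      proof (rule antisym)
        show "inner_content F \<le> inner_content (h i ` F)"
          using h i j m F by (intro inner_image_le[of "h i" "h j"]) auto
        have "inner_content (h i ` F) \<le> inner_content (h j ` h i ` F)"
          using h i j m closedin_subset[OF hF] by (intro inner_image_le[of "h j" "h i"]) auto
        also have "h j ` h i ` F = F" using j(2) F(2) by (force simp: image_image)
        finally show "inner_content (h i ` F) \<le> inner_content F" .
      qed
      also have "\<dots> = emeasure \<mu> F" using \<mu>(2)[OF F(1)] by simp
      finally show "emeasure (distr \<mu> \<mu> (h j)) F = emeasure \<mu> F" .
    next
      have "emeasure (distr \<mu> \<mu> (h j)) (topspace T) \<le> emeasure \<mu> (topspace T)"
        using meas sp emeasure_space[of \<mu>] by (subst emeasure_distr) (auto simp flip: sp)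
      then show "emeasure (distr \<mu> \<mu> (h j)) (topspace T) \<noteq> \<infinity>" for i :: nat using fin by (auto simp: top_unique)
    qed (auto simp: clE)
    then have "emeasure \<mu> A = emeasure (distr \<mu> \<mu> (h j)) A" by simp
    also have "\<dots> = emeasure \<mu> (h j -` A \<inter> topspace T)" using meas A sp by (simp add: emeasure_distr)
    also have "\<dots> = emeasure \<mu> (h i ` A)" using im[of A] sets.sets_into_space[OF A] sp by simp
    finally show ?thesis by simp
  qed
  \<comment> \<open>Normalization is possible since the total mass is at most \<open>c\<close> and,
    because of \<open>K\<close>, at least \<open>e\<close>.\<close>
  define \<nu> where "\<nu> = scale_measure (1 / emeasure \<mu> (topspace T)) \<mu>"
  have "prob_space \<nu>"
  proof
    show "emeasure \<nu> (space \<nu>) = 1"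
      using pos fin ennreal_divide_times[of 1 "emeasure \<mu> (topspace T)" "emeasure \<mu> (topspace T)"]
      by (simp add: \<nu>_def space_scale_measure sp ennreal_divide_self less_top)
  qed
  moreover have "sets \<nu> = sets (borel_of T)" using \<mu>(1) by (simp add: \<nu>_def)
  moreover have "\<forall>i\<in>I. \<forall>A\<in>sets (borel_of T). emeasure \<nu> (h i ` A) = emeasure \<nu> A"
    using inv\<mu> \<mu>(1) by (simp add: \<nu>_def)
  ultimately show ?thesis by blast
qed

end

section \<open>Coding a generating sequence\<close>

text \<open>Addresses the \<open>k\<close>-th usable place, counted from 0, by the number of earlier
  ones, a count that is measurable. Start with the least element, then pass to the least one beyond
  the current.\<close>

lemma ex_counted_element:
  fixes S :: "nat set"
  assumes "infinite S" shows "\<exists>n\<in>S. (\<Sum>m<n. if m \<in> S then 1 else 0 :: nat) = k"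
proof (induction k)
  case 0
  obtain n0 where n0: "n0 \<in> S" using assms by (metis ex_in_conv finite.emptyI)
  define n where "n = (LEAST n. n \<in> S)"
  have "n \<in> S" "\<And>m. m < n \<Longrightarrow> m \<notin> S" using n0 unfolding n_def by (auto intro: LeastI dest: not_less_Least)
  then show ?case by (intro bexI[of _ n]) auto
next
  case (Suc k)
  then obtain n where n: "n \<in> S" "(\<Sum>m<n. if m \<in> S then 1 else 0 :: nat) = k" by blast
  obtain n1 where n1: "n1 \<in> S" "n < n1" using assms by (meson infinite_nat_iff_unbounded)
  define n' where "n' = (LEAST j. j \<in> S \<and> n < j)"
  have n': "n' \<in> S" "n < n'" using LeastI[of "\<lambda>j. j \<in> S \<and> n < j" n1] n1 unfolding n'_def by auto
  have least: "m \<notin> S" if "n < m" "m < n'" for m using not_less_Least[of m "\<lambda>j. j \<in> S \<and> n < j"] that unfolding n'_def by blast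
  have "{..<n'} = {..<n} \<union> {n} \<union> {n<..<n'}" using n'(2) by auto
  then have "(\<Sum>m<n'. if m \<in> S then 1 else 0 :: nat) = (\<Sum>m\<in>{..<n} \<union> {n} \<union> {n<..<n'}. if m \<in> S then 1 else 0)" by simp
  also have "\<dots> = k + 1 + (\<Sum>m\<in>{n<..<n'}. if m \<in> S then 1 else 0)"
    using n by (subst sum.union_disjoint, auto)+
  also have "(\<Sum>m\<in>{n<..<n'}. if m \<in> S then 1 else 0 :: nat) = 0" using least by (intro sum.neutral) auto
  finally show ?case using n'(1) by (intro bexI[of _ n']) auto
qed

text \<open>The pieces are the eight atoms of \<open>A\<close>, \<open>B\<close>, \<open>C\<close>,
  numbered in binary; pieces from index 8 on are empty. The hypothesis \<open>gen\<close> is applied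
  to the sigma-algebra generated by all translates of the pieces.\<close>

lemma generator_of_pieces:
  assumes X: "meas_action G X \<phi>" and ABC: "A \<in> sets X" "B \<in> sets X" "C \<in> sets X" and k: "8 \<le> k"
    and gen: "\<And>N. \<lbrakk>meas_action G N \<phi>; space N = space X; A \<in> sets N; B \<in> sets N; C \<in> sets N\<rbrakk> \<Longrightarrow> sets X \<subseteq> sets N"
  shows "\<exists>P. generator G X \<phi> k P"
proof -
  interpret X: meas_action G X \<phi> by fact
  define code where "code x = (if x \<in> A then 1 else 0) + (if x \<in> B then 2 else 0) + (if x \<in> C then 4 else (0::nat))" for x
  define P where "P n = {x \<in> space X. code x = n}" for n
  have code_less: "code x < k" for x using k by (auto simp: code_def)
  have Ps: "P n \<in> sets X" for n
  proof -
    have [measurable]: "code \<in> measurable X (count_space UNIV)" unfolding code_def using ABC by measurable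
    show ?thesis unfolding P_def by measurable
  qed
  let ?E = "{\<phi> g ` P n | g n. g \<in> carrier G \<and> n < k}"
  have EP: "?E \<subseteq> sets X" using Ps X.act_image_sets by auto
  then have EP': "?E \<subseteq> Pow (space X)" using sets.sets_into_space by blast
  define N where "N = sigma (space X) ?E"
  have sN: "space N = space X" "sets N = sigma_sets (space X) ?E" using EP' by (simp_all add: N_def)
  have PN: "P n \<in> sets N" for n
  proof (cases "n < k")
    case True
    have "\<phi> \<one>\<^bsub>G\<^esub> ` P n = P n" using X.act_one by (force simp: P_def)
    then have "P n \<in> ?E" using True by (metis (mono_tags, lifting) X.one_closed mem_Collect_eq)
    then show ?thesis unfolding sN by (rule sigma_sets.Basic)
  next
    case False
    then have "P n = {}" using code_less by (auto simp: P_def)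
    then show ?thesis by simp
  qed
  \<comment> \<open>A preimage of a translate of a piece is again such a translate, so the action is
    measurable for the generated sigma-algebra.\<close>
  have "meas_action G N \<phi>"
  proof (intro meas_action.intro meas_action_axioms.intro X.is_group X.countable_carrier)
    fix g assume g: "g \<in> carrier G"
    show "\<phi> g \<in> measurable N N"
      unfolding N_def
    proof (rule measurable_measure_of[OF EP'])
      show "\<phi> g \<in> space (sigma (space X) ?E) \<rightarrow> space X" using g EP' by auto
      fix y assume "y \<in> ?E"
      then obtain h n where y: "y = \<phi> h ` P n" "h \<in> carrier G" "n < k" by auto
      have "\<phi> g -` y \<inter> space X = \<phi> (inv\<^bsub>G\<^esub> g \<otimes>\<^bsub>G\<^esub> h) ` P n"
      proof -
        have sub: "P n \<subseteq> space X" by (auto simp: P_def)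
        have "\<phi> g -` y \<inter> space X = {x \<in> space X. \<phi> (inv\<^bsub>G\<^esub> h) (\<phi> g x) \<in> P n}"
          using g y sub by (auto simp: X.act_image_eq)
        also have "\<dots> = {x \<in> space X. \<phi> (inv\<^bsub>G\<^esub> (inv\<^bsub>G\<^esub> g \<otimes>\<^bsub>G\<^esub> h)) x \<in> P n}"
          using g y by (auto simp: X.inv_mult_group X.act_mult)
        also have "\<dots> = \<phi> (inv\<^bsub>G\<^esub> g \<otimes>\<^bsub>G\<^esub> h) ` P n" using g y sub by (simp add: X.act_image_eq)
        finally show ?thesis .
      qed
      also have "\<dots> \<in> ?E" using g y by blast
      finally show "\<phi> g -` y \<inter> space (sigma (space X) ?E) \<in> sets (sigma (space X) ?E)"
        using EP' by (simp add: sigma_sets.Basic)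
    qed
  qed (simp_all add: sN X.act_mult)
  moreover have "A \<in> sets N" "B \<in> sets N" "C \<in> sets N"
  proof -
    have "A = (\<Union>n\<in>{1,3,5,7}. P n)" "B = (\<Union>n\<in>{2,3,6,7}. P n)" "C = (\<Union>n\<in>{4,5,6,7}. P n)"
      using ABC[THEN sets.sets_into_space] by (auto simp: P_def code_def split: if_splits)
    then show "A \<in> sets N" "B \<in> sets N" "C \<in> sets N"
      using PN by (metis finite.emptyI finite.insertI sets.finite_UN)+
  qed
  ultimately have "sets X \<subseteq> sigma_sets (space X) ?E" using gen[of N] sN by simp
  moreover have "sigma_sets (space X) ?E \<subseteq> sets X" using EP by (rule sets.sigma_sets_subset)
  ultimately have "sigma_sets (space X) ?E = sets X" by blast
  moreover have "disjoint_family_on P {..<k}" by (auto simp: disjoint_family_on_def P_def)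
  moreover have "(\<Union>n<k. P n) = space X" using code_less by (auto simp: P_def)
  ultimately have "generator G X \<phi> k P" using Ps by (simp add: generator_def)
  then show ?thesis by blast
qed

text \<open>The third set \<open>C\<close> stores, at the place of the \<open>k\<close>-th usable token of a point \<open>x\<close>, the bit telling
  whether \<open>x \<in> U k\<close>. The tokens are read off the itinerary of \<open>x\<close> with respect to \<open>A\<close> and \<open>B\<close>.\<close>

lemma generator_of_traveling_itinerary:
  fixes X :: "'a measure" and U :: "nat \<Rightarrow> 'a set"
  assumes X: "meas_action G X \<phi>" and AB: "A \<in> sets X" "B \<in> sets X"
    and tr: "token_action.traveling G (shift_space G) (shift_act G) R"
    and R: "\<And>x. x \<in> space X \<Longrightarrow> itinerary G \<phi> A B x \<in> R"
    and U: "sets X = sigma_sets (space X) (range U)" and k: "8 \<le> k"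
  shows "\<exists>P. generator G X \<phi> k P"
proof -
  interpret X: meas_action G X \<phi> by fact
  interpret S: token_action G "shift_space G" "shift_act G"
    by (intro token_actionI meas_action_shift X.is_group X.countable_carrier)
  define f where "f = itinerary G \<phi> A B"
  have f: "f x \<in> space (shift_space G)" for x unfolding f_def by (rule X.itinerary_space)
  have f_act: "f (\<phi> g x) = shift_act G g (f x)" if "g \<in> carrier G" "x \<in> space X" for g x
    unfolding f_def using that by (rule X.itinerary_act)
  obtain Q \<gamma> where \<gamma>: "S.tk.embeds \<gamma> Q (space (shift_space G) \<times> {0})"
    and Q: "\<And>s. s \<in> R \<Longrightarrow> \<exists>g\<in>carrier G. infinite {n::nat. (shift_act G g s, int n) \<in> Q}"
    using tr unfolding S.traveling_def S.tk.le_def by blast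
  \<comment> \<open>\<open>u n x\<close>: the \<open>n\<close>-th token of \<open>x\<close> is
    usable; \<open>t n x\<close> moves \<open>x\<close> to its place; \<open>idx n x\<close> counts
    the usable tokens before it.\<close>
  define u where "u n x \<longleftrightarrow> (f x, int n) \<in> Q" for n x
  define t where "t n x = fst (\<gamma> (f x, int n))" for n x
  define idx where "idx n x = (\<Sum>m<n. if u m x then 1 else 0 :: nat)" for n x
  \<comment> \<open>The target has copy number 0, so the integer component must be
    \<open>- n\<close>.\<close>
  have t: "t n x \<in> carrier G" "\<gamma> (f x, int n) = (t n x, - int n)" if "u n x" for n x
  proof -
    obtain g d where gd: "\<gamma> (f x, int n) = (g, d)" by (cases "\<gamma> (f x, int n)")
    have "\<gamma> (f x, int n) \<in> carrier S.H"
      "token_act (shift_act G) (\<gamma> (f x, int n)) (f x, int n) \<in> space (shift_space G) \<times> {0}"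
      using \<gamma> that unfolding S.tk.embeds_def u_def by auto
    then show "t n x \<in> carrier G" "\<gamma> (f x, int n) = (t n x, - int n)" using gd by (auto simp: t_def)
  qed
  \<comment> \<open>Itineraries need not separate points. Equal places have equal itineraries, so
    the embedding gives \<open>f x = f y\<close> and \<open>n = m\<close>; then the moving elements
    agree, and cancelling them gives \<open>x = y\<close>.\<close>
  have inj: "x = y \<and> n = m" if "u n x" "u m y" "x \<in> space X" "y \<in> space X" "\<phi> (t n x) x = \<phi> (t m y) y" for n m x y
  proof -
    have "shift_act G (t n x) (f x) = shift_act G (t m y) (f y)" using that t by (metis f_act)
    then have "token_act (shift_act G) (\<gamma> (f x, int n)) (f x, int n) = token_act (shift_act G) (\<gamma> (f y, int m)) (f y, int m)"
      using that t by simp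
    then have eq: "(f x, int n) = (f y, int m)"
      using \<gamma> that(1,2) unfolding S.tk.embeds_def u_def inj_on_def by blast
    then have "t n x = t m y" by (simp add: t_def)
    then show ?thesis using eq that t(1)[OF that(1)] X.act_inj[of "t n x" x y] by simp
  qed
  \<comment> \<open>All three data are functions of the itinerary, hence measurable for every
    \<open>N\<close> with measurable action that contains \<open>A\<close> and \<open>B\<close>.
    Decoding rests on this.\<close>
  have u_meas: "{x \<in> space N. u n x} \<in> sets N" "{x \<in> space N. u n x \<and> t n x = g} \<in> sets N"
    "idx n \<in> measurable N (count_space UNIV)"
    if N: "meas_action G N \<phi>" "A \<in> sets N" "B \<in> sets N" and g: "g \<in> carrier G" for N :: "'a measure" and n g
  proof -
    have fN: "f \<in> measurable N (shift_space G)"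
      unfolding f_def using N by (intro meas_action.itinerary_measurable)
    have pre: "{x \<in> space N. (f x, int n) \<in> Q'} \<in> sets N" if "Q' \<in> sets S.TM" for Q' n
    proof -
      have "{x \<in> space N. (f x, int n) \<in> Q'} = f -` {s \<in> space (shift_space G). (s, int n) \<in> Q'} \<inter> space N"
        using f by auto
      then show ?thesis using measurable_sets[OF fN S.section_sets[OF that]] by simp
    qed
    have Qs: "Q \<in> sets S.TM" "{z \<in> Q. \<gamma> z = h} \<in> sets S.TM" if "h \<in> carrier S.H" for h
      using \<gamma> that unfolding S.tk.embeds_def by auto
    show un: "{x \<in> space N. u n x} \<in> sets N" for n using pre[OF Qs(1)[of "(g, 0)"]] g by (simp add: u_def)
    have "u n x \<and> t n x = g \<longleftrightarrow> (f x, int n) \<in> {z \<in> Q. \<gamma> z = (g, - int n)}" for x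
      using t(2)[of n x] by (cases "u n x") (auto simp: u_def)
    then have "{x \<in> space N. u n x \<and> t n x = g} = {x \<in> space N. (f x, int n) \<in> {z \<in> Q. \<gamma> z = (g, - int n)}}"
      by (simp only:)
    then show "{x \<in> space N. u n x \<and> t n x = g} \<in> sets N" using pre[OF Qs(2)[of "(g, - int n)"]] g by simp
    have [measurable]: "Measurable.pred N (u m)" for m using un by (simp add: pred_def)
    show "idx n \<in> measurable N (count_space UNIV)" unfolding idx_def by measurable
  qed
  have Us: "U n \<in> sets X" for n unfolding U by (rule sigma_sets.Basic) simp
  define C where "C = (\<Union>n. \<Union>g\<in>carrier G. \<Union>j. \<phi> g ` {x \<in> space X. (u n x \<and> t n x = g) \<and> idx n x = j \<and> x \<in> U j})"
  have C_iff: "\<phi> (t n x) x \<in> C \<longleftrightarrow> x \<in> U (idx n x)" if "u n x" "x \<in> space X" for n x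
  proof
    assume "x \<in> U (idx n x)" then show "\<phi> (t n x) x \<in> C" using that t(1)[OF that(1)] unfolding C_def by blast
  next
    assume "\<phi> (t n x) x \<in> C"
    then obtain m y where y: "y \<in> space X" "u m y" "y \<in> U (idx m y)" "\<phi> (t n x) x = \<phi> (t m y) y"
      unfolding C_def by blast
    then show "x \<in> U (idx n x)" using inj[OF that(1) y(2) that(2) y(1,4)] by simp
  qed
  have "\<phi> g ` {x \<in> space X. (u n x \<and> t n x = g) \<and> idx n x = j \<and> x \<in> U j} \<in> sets X"
    if g: "g \<in> carrier G" for n g j
  proof (rule X.act_image_sets[OF g])
    have [measurable]: "idx n \<in> measurable X (count_space UNIV)" "U j \<in> sets X"
      "{x \<in> space X. u n x \<and> t n x = g} \<in> sets X" using u_meas[OF X AB g] Us by auto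
    have "{x \<in> space X. (u n x \<and> t n x = g) \<and> idx n x = j \<and> x \<in> U j} =
      {x \<in> space X. u n x \<and> t n x = g} \<inter> {x \<in> space X. idx n x = j \<and> x \<in> U j}" by auto
    also have "\<dots> \<in> sets X" by measurable
    finally show "{x \<in> space X. (u n x \<and> t n x = g) \<and> idx n x = j \<and> x \<in> U j} \<in> sets X" .
  qed
  then have C: "C \<in> sets X" unfolding C_def
    using X.countable_carrier by (intro sets.countable_UN' sets.countable_UN) auto
  have "sets X \<subseteq> sets N"
    if N: "meas_action G N \<phi>" "space N = space X" and ABC: "A \<in> sets N" "B \<in> sets N" "C \<in> sets N" for N
  proof -
    interpret N: meas_action G N \<phi> by fact
    define D where "D = {x \<in> space N. infinite {n. u n x}}"
    note uN = u_meas[OF N(1) ABC(1,2)]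
    have D: "D \<in> sets N"
    proof -
      have "D = {x \<in> space N. \<forall>m::nat. \<exists>n\<in>{m..}. u n x}"
        unfolding D_def infinite_nat_iff_unbounded_le by auto
      also have "\<dots> \<in> sets N"
        by (intro sets.sets_Collect_countable_All sets.sets_Collect_countable_Ex' uN(1)[OF X.one_closed]) auto
      finally show ?thesis .
    qed
    \<comment> \<open>A point of \<open>D\<close> has a usable token with exactly \<open>j\<close>
      predecessors, and the bit stored at its place answers membership in
      \<open>U j\<close>.\<close>
    have UD: "U j \<inter> D \<in> sets N" for j
    proof -
      have "U j \<inter> D = D \<inter> (\<Union>n. \<Union>g\<in>carrier G. {x \<in> space N. u n x \<and> t n x = g} \<inter> {x \<in> space N. idx n x = j} \<inter> {x \<in> space N. \<phi> g x \<in> C})"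
      proof (intro Set.set_eqI iffI)
        fix x assume x: "x \<in> U j \<inter> D"
        then have "infinite {n. u n x}" "x \<in> space X" using N by (auto simp: D_def)
        then obtain n where n: "u n x" "idx n x = j" using ex_counted_element[of "{n. u n x}" j] by (auto simp: idx_def)
        have "\<phi> (t n x) x \<in> C" using C_iff[OF n(1) \<open>x \<in> space X\<close>] n x by simp
        then show "x \<in> D \<inter> (\<Union>n. \<Union>g\<in>carrier G. {x \<in> space N. u n x \<and> t n x = g} \<inter> {x \<in> space N. idx n x = j} \<inter> {x \<in> space N. \<phi> g x \<in> C})"
          using x n t(1)[OF n(1)] \<open>x \<in> space X\<close> N(2) by auto
      next
        fix x assume x: "x \<in> D \<inter> (\<Union>n. \<Union>g\<in>carrier G. {x \<in> space N. u n x \<and> t n x = g} \<inter> {x \<in> space N. idx n x = j} \<inter> {x \<in> space N. \<phi> g x \<in> C})"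
        then obtain n where "u n x" "idx n x = j" "\<phi> (t n x) x \<in> C" "x \<in> space X" using N(2) by auto
        then show "x \<in> U j \<inter> D" using C_iff x by auto
      qed
      moreover have "{x \<in> space N. idx n x = j} \<in> sets N" for n
        using measurable_sets[OF uN(3)[OF X.one_closed], of "{j}"] by (simp add: vimage_def Int_def conj_commute)
      ultimately show ?thesis using D uN(2) ABC(3)
        by (auto intro!: sets.Int sets.countable_UN' X.countable_carrier N.act_vimage_sets)
    qed
    have ED: "E \<inter> D \<in> sets N" if "E \<in> sets X" for E
      using that unfolding U
    proof (induction rule: sigma_sets.induct)
      case (Basic a) then show ?case using UD by auto
    next
      case (Compl a)
      have "(space X - a) \<inter> D = D - a \<inter> D" using N by (auto simp: D_def)
      then show ?case using Compl.IH D by simp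
    next
      case (Union a)
      have "(\<Union>n. a n) \<inter> D = (\<Union>n. a n \<inter> D)" by auto
      then show ?case using Union.IH by (simp only:) (intro sets.countable_UN, auto)
    qed auto
    show ?thesis
    proof
      fix E assume E: "E \<in> sets X"
      then have Esub: "E \<subseteq> space X" by (rule sets.sets_into_space)
      \<comment> \<open>Every orbit meets \<open>D\<close>, so a point is decoded after being moved
        there.\<close>
      have "E = (\<Union>g\<in>carrier G. {x \<in> space N. \<phi> g x \<in> \<phi> g ` E \<inter> D})"
      proof (intro Set.set_eqI iffI)
        fix x assume x: "x \<in> E"
        then have xs: "x \<in> space X" using Esub by blast
        obtain g where g: "g \<in> carrier G" "infinite {n::nat. (shift_act G g (f x), int n) \<in> Q}"
          using Q R xs by (metis f_def)
        then have "\<phi> g x \<in> D" using xs N(2) by (simp add: D_def u_def f_act)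
        then show "x \<in> (\<Union>g\<in>carrier G. {x \<in> space N. \<phi> g x \<in> \<phi> g ` E \<inter> D})" using g x xs N(2) by auto
      next
        fix x assume "x \<in> (\<Union>g\<in>carrier G. {x \<in> space N. \<phi> g x \<in> \<phi> g ` E \<inter> D})"
        then obtain g y where "g \<in> carrier G" "x \<in> space X" "y \<in> E" "\<phi> g x = \<phi> g y" using N(2) by auto
        then show "x \<in> E" using X.act_inj Esub by (metis subsetD)
      qed
      also have "\<dots> \<in> sets N"
      proof -
        have "{x \<in> space N. \<phi> g x \<in> \<phi> g ` E \<inter> D} \<in> sets N" if "g \<in> carrier G" for g
          by (intro N.act_vimage_sets ED X.act_image_sets that E)
        then show ?thesis by (intro sets.countable_UN' X.countable_carrier) auto
      qed
      finally show "E \<in> sets N" .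
    qed
  qed
  then show ?thesis by (rule generator_of_pieces[OF X AB C k]) 
qed

section \<open>The content of a non-wandering point\<close>

lemma ex_rat_between:
  assumes "0 \<le> a" "a < (b::real)"
  obtains p q :: nat where "0 < q" "a < real p / real q" "real p / real q < b"
proof -
  obtain r where r: "r \<in> \<rat>" "a < r" "r < b" using Rats_dense_in_real[OF assms(2)] by blast
  obtain p q :: nat where "q \<noteq> 0" "\<bar>r\<bar> = real p / real q" using Rats_abs_nat_div_natE[OF r(1)] by metis
  then show thesis using that[of q p] r assms by auto
qed

text \<open>Abstract form of the two relations at a fixed point \<open>x\<close>:
  \<open>up A q p\<close> bounds the value of \<open>A\<close> above by \<open>p/q\<close>,
  \<open>dn A q p\<close> below. \<open>up_1_2\<close> keeps the set of upper bounds
  nonempty.\<close>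

locale rational_cut =
  fixes up dn :: "'s \<Rightarrow> nat \<Rightarrow> nat \<Rightarrow> bool" and \<C> :: "'s set"
  assumes total: "A \<in> \<C> \<Longrightarrow> up A q p \<or> dn A q p"
    and dn_0: "A \<in> \<C> \<Longrightarrow> dn A q 0"
    and up_1_2: "A \<in> \<C> \<Longrightarrow> up A 1 2"
begin

definition cut :: "'s \<Rightarrow> real" where
  "cut A = Inf {real p / real q | p q. 0 < q \<and> up A q p}"

lemma cut_lower: "\<lbrakk>0 < q; up A q p\<rbrakk> \<Longrightarrow> cut A \<le> real p / real q"
  unfolding cut_def by (rule cInf_lower) (auto intro!: bdd_belowI[of _ 0])

lemma cut_nonempty: "A \<in> \<C> \<Longrightarrow> {real p / real q | p q. 0 < q \<and> up A q p} \<noteq> {}"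
  using up_1_2[of A] zero_less_one by blast

lemma cut_nonneg: "A \<in> \<C> \<Longrightarrow> 0 \<le> cut A"
  unfolding cut_def by (rule cInf_greatest[OF cut_nonempty]) auto

lemma cut_le_2: "A \<in> \<C> \<Longrightarrow> cut A \<le> 2"
  using cut_lower[of 1 A 2] up_1_2 by simp

lemma ex_up:
  assumes "A \<in> \<C>" "cut A < r"
  shows "\<exists>p q. 0 < q \<and> up A q p \<and> real p / real q < r"
proof -
  have "\<exists>s\<in>{real p / real q | p q. 0 < q \<and> up A q p}. s < r"
    using cInf_lessD[OF cut_nonempty] assms unfolding cut_def by blast
  then show ?thesis by blast
qed

text \<open>A fraction strictly below the infimum cannot be an upper bound, so \<open>total\<close>
  makes it a lower one. Negative \<open>r\<close> is served by the fraction 0.\<close>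

lemma ex_dn:
  assumes A: "A \<in> \<C>" and r: "r < cut A"
  shows "\<exists>p q. 0 < q \<and> dn A q p \<and> r < real p / real q"
proof (cases "r < 0")
  case True
  then have "r < real 0 / real 1" by simp
  then show ?thesis using dn_0[OF A] zero_less_one by blast
next
  case False
  then obtain p q where "0 < q" "r < real p / real q" "real p / real q < cut A"
    using ex_rat_between[of r "cut A"] r by (metis linorder_not_less)
  moreover from this have "dn A q p" using total[OF A, of q p] cut_lower[of q A p] by auto
  ultimately show ?thesis by blast
qed

end

text \<open>Bridge between integer multiples, in which compressions are stated, and quotients, in
  which the content is computed.\<close>

lemma frac_add_less_iff:
  assumes "0 < q" "0 < q'" "0 < (q''::nat)"
  shows "q'' * (p * q' + p' * q) < p'' * (q * q') \<longleftrightarrow> real p / real q + real p' / real q' < real p'' / real q''"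
    and "p'' * (q * q') < q'' * (p * q' + p' * q) \<longleftrightarrow> real p'' / real q'' < real p / real q + real p' / real q'"
proof -
  have 1: "real p / real q + real p' / real q' = real (p * q' + p' * q) / real (q * q')"
    using assms by (simp add: add_frac_eq)
  have q: "0 < real (q * q')" "0 < real q''" using assms by simp_all
  show "q'' * (p * q' + p' * q) < p'' * (q * q') \<longleftrightarrow> real p / real q + real p' / real q' < real p'' / real q''"
    unfolding 1 pos_divide_less_eq[OF q(1)] times_divide_eq_left pos_less_divide_eq[OF q(2)]
    by (metis (no_types) mult.commute of_nat_less_iff of_nat_mult)
  show "p'' * (q * q') < q'' * (p * q' + p' * q) \<longleftrightarrow> real p'' / real q'' < real p / real q + real p' / real q'"
    unfolding 1 pos_divide_less_eq[OF q(2)] times_divide_eq_left pos_less_divide_eq[OF q(1)]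
    by (metis (no_types) mult.commute of_nat_less_iff of_nat_mult)
qed

lemma (in token_action) dn_zero:
  assumes "A \<in> sets M" shows "dn A q 0 = space M"
proof -
  have e: "tok (space M) 0 = {}" by (simp add: tok_def)
  have "tk.rest2 (tok A q) (tok (space M) 0) = {}"
    using tk.rest_subset(2)[of "tok A q" "{}"] assms unfolding e by auto
  then show ?thesis by (auto simp: dn_def tk.full2_def base_def)
qed

locale sigma_compact_action = meas_action G X \<phi> for G :: "('g, 'm) monoid_scheme" (structure)
    and X :: "'a measure" and \<phi> :: "'g \<Rightarrow> 'a \<Rightarrow> 'a" +
  fixes T :: "'a topology" and \<B> :: "'a set set" and K :: "nat \<Rightarrow> 'a set"
  assumes Hausdorff: "Hausdorff_space T"
    and borel: "sets (borel_of T) = sets X"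
    and cont: "g \<in> carrier G \<Longrightarrow> continuous_map T T (\<phi> g)"
    and countable_\<B>: "countable \<B>" and open_\<B>: "B \<in> \<B> \<Longrightarrow> openin T B"
    and base_\<B>: "\<lbrakk>openin T V; x \<in> V\<rbrakk> \<Longrightarrow> \<exists>B\<in>\<B>. x \<in> B \<and> B \<subseteq> V"
    and compact_K: "compactin T (K n)" and UN_K: "(\<Union>n. K n) = topspace T"
begin

section \<open>Borel sets of the realization and a countable invariant family of open sets\<close>

lemma topspace_eq: "topspace T = space X"
  using sets_eq_imp_space_eq[OF borel] by (auto simp: borel_of_def space_measure_of_conv)

lemma openin_sets: "openin T U \<Longrightarrow> U \<in> sets X"
  unfolding borel[symmetric] borel_of_def by (auto dest: openin_subset intro: sigma_sets.Basic)

lemma closedin_sets: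
  assumes "closedin T F" shows "F \<in> sets X"
proof -
  have "space X - (topspace T - F) \<in> sets X"
    using assms by (intro sets.compl_sets openin_sets) auto
  moreover have "space X - (topspace T - F) = F" using closedin_subset[OF assms] by (auto simp: topspace_eq)
  ultimately show ?thesis by simp
qed

lemma base_generates: "sets X = sigma_sets (space X) \<B>"
proof (rule equalityI)
  have "U \<in> sigma_sets (space X) \<B>" if "openin T U" for U
  proof -
    have "U = \<Union>{B \<in> \<B>. B \<subseteq> U}" using base_\<B>[OF that] by blast
    also have "\<dots> \<in> sigma_sets (space X) \<B>"
    proof (rule sigma_sets_UNION)
      show "countable {B \<in> \<B>. B \<subseteq> U}" using countable_\<B> by (rule countable_subset[rotated]) auto
    qed (auto intro: sigma_sets.Basic)
    finally show ?thesis .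
  qed
  then have "sigma_sets (space X) {U. openin T U} \<subseteq> sigma_sets (space X) \<B>" by (intro sigma_sets_mono) auto
  moreover have "sets X = sigma_sets (space X) {U. openin T U}"
    unfolding borel[symmetric] borel_of_def topspace_eq[symmetric]
    by (rule sets_measure_of) (auto dest: openin_subset)
  ultimately show "sets X \<subseteq> sigma_sets (space X) \<B>" by simp
  show "sigma_sets (space X) \<B> \<subseteq> sets X"
    using openin_sets open_\<B> by (intro sets.sigma_sets_subset) auto
qed

text \<open>Translates make the family invariant, and finite unions let it interpolate between
  compact and open sets. It stays countable, so only countably many pairs \<open>A\<close>,
  \<open>B\<close> have to be glued.\<close>

definition opens :: "'a set set" where
  "opens = \<Union> ` {\<F>. finite \<F> \<and> \<F> \<subseteq> (\<lambda>(g, B). \<phi> g ` B) ` (carrier G \<times> \<B>)}"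

lemma countable_opens: "countable opens"
  unfolding opens_def
  by (intro countable_image countable_Collect_finite_subset countable_SIGMA countable_carrier countable_\<B>)

lemma open_image: "\<lbrakk>g \<in> carrier G; openin T U\<rbrakk> \<Longrightarrow> openin T (\<phi> g ` U)"
  using openin_continuous_map_preimage[OF cont[of "inv g"], of U] openin_subset[of T U]
  by (simp add: act_image_eq topspace_eq)

lemma openin_opens:
  assumes "U \<in> opens" shows "openin T U"
proof -
  obtain \<F> where F: "\<F> \<subseteq> (\<lambda>(g, B). \<phi> g ` B) ` (carrier G \<times> \<B>)" "U = \<Union>\<F>"
    using assms by (auto simp: opens_def)
  have "openin T V" if "V \<in> \<F>" for V using subsetD[OF F(1) that] open_image open_\<B> by auto
  then show ?thesis unfolding F(2) by (rule openin_Union)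
qed

lemma opens_Un: "\<lbrakk>U \<in> opens; V \<in> opens\<rbrakk> \<Longrightarrow> U \<union> V \<in> opens"
  unfolding opens_def
proof clarify
  fix \<F> \<F>' assume a: "finite \<F>" "\<F> \<subseteq> (\<lambda>(g, B). \<phi> g ` B) ` (carrier G \<times> \<B>)"
    "finite \<F>'" "\<F>' \<subseteq> (\<lambda>(g, B). \<phi> g ` B) ` (carrier G \<times> \<B>)"
  then show "\<Union>\<F> \<union> \<Union>\<F>' \<in> \<Union> ` {\<F>. finite \<F> \<and> \<F> \<subseteq> (\<lambda>(g, B). \<phi> g ` B) ` (carrier G \<times> \<B>)}"
    by (intro image_eqI[of _ _ "\<F> \<union> \<F>'"]) simp_all
qed

lemma opens_act:
  assumes h: "h \<in> carrier G" and U: "U \<in> opens" shows "\<phi> h ` U \<in> opens"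
proof -
  obtain \<F> where F: "finite \<F>" "\<F> \<subseteq> (\<lambda>(g, B). \<phi> g ` B) ` (carrier G \<times> \<B>)" "U = \<Union>\<F>"
    using U by (auto simp: opens_def)
  have *: "\<phi> h ` \<phi> g ` B = \<phi> (h \<otimes> g) ` B" if "g \<in> carrier G" "B \<in> \<B>" for g B
  proof -
    have "B \<subseteq> space X" using openin_subset[OF open_\<B>[OF that(2)]] topspace_eq by simp
    then have "\<phi> h (\<phi> g x) = \<phi> (h \<otimes> g) x" if "x \<in> B" for x
      using act_mult[OF h \<open>g \<in> carrier G\<close>] that by auto
    then show ?thesis unfolding image_image by (rule image_cong[OF refl])
  qed
  have "(`) (\<phi> h) ` \<F> \<subseteq> (\<lambda>(g, B). \<phi> g ` B) ` (carrier G \<times> \<B>)"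
  proof (rule image_subsetI)
    fix V assume "V \<in> \<F>"
    then obtain g B where V: "g \<in> carrier G" "B \<in> \<B>" "V = \<phi> g ` B" using F(2) by auto
    then show "\<phi> h ` V \<in> (\<lambda>(g, B). \<phi> g ` B) ` (carrier G \<times> \<B>)"
      using h * by (intro image_eqI[of _ _ "(h \<otimes> g, B)"]) simp_all
  qed
  moreover have "\<phi> h ` U = \<Union>((`) (\<phi> h) ` \<F>)" unfolding F(3) by blast
  ultimately show ?thesis unfolding opens_def using F(1)
    by (intro image_eqI[of _ _ "(`) (\<phi> h) ` \<F>"]) simp_all
qed

lemma opens_separate:
  assumes C: "compactin T C" and V: "openin T V" "C \<subseteq> V"
  shows "\<exists>U\<in>opens. C \<subseteq> U \<and> U \<subseteq> V"
proof -
  let ?\<V> = "{B \<in> \<B>. B \<subseteq> V}"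
  have "C \<subseteq> \<Union>?\<V>" using base_\<B>[OF V(1)] V(2) by blast
  then obtain \<F> where F: "finite \<F>" "\<F> \<subseteq> ?\<V>" "C \<subseteq> \<Union>\<F>"
    using C[unfolded compactin_def, THEN conjunct2, THEN spec, of ?\<V>] open_\<B> by auto
  have "B \<in> (\<lambda>(g, B). \<phi> g ` B) ` (carrier G \<times> \<B>)" if "B \<in> \<B>" for B
  proof -
    have "\<phi> \<one> ` B = B" using openin_subset[OF open_\<B>[OF that]] topspace_eq by force
    then show ?thesis using that by (intro image_eqI[of _ _ "(\<one>, B)"]) auto
  qed
  then have "\<Union>\<F> \<in> opens" unfolding opens_def using F by (intro imageI) auto
  then show ?thesis using F by blast
qed

end

lemma frac_less_iff:
  assumes "0 < q" "0 < (q'::nat)"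
  shows "p * q' < p' * q \<longleftrightarrow> real p / real q < real p' / real q'"
  using frac_add_less_iff(1)[of q 1 q' p 0 p'] assms by (simp add: mult.commute)

context sigma_compact_action
begin

text \<open>If no orbit configuration at \<open>x\<close> is wandering, then comparing \<open>q\<close> copies of \<open>A\<close> with \<open>p\<close> copies of
  the space by greedy matching at \<open>x\<close> defines a finitely additive invariant content.\<close>

lemma invariant_measure_of_nonwandering:
  assumes x: "x \<in> space X"
    and R1: "\<And>p q p' q' p'' q''. q'' * (p * q' + p' * q) < p'' * (q * q') \<Longrightarrow>
      token_action.up G (shift_space G) (shift_act G) (cyl1 G) q p \<inter>
      token_action.up G (shift_space G) (shift_act G) (cyl2 G) q' p' \<inter>
      token_action.dn G (shift_space G) (shift_act G) (cyl1 G \<union> cyl2 G) q'' p'' \<subseteq> R"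
    and R2: "\<And>p q p' q' p'' q''. p'' * (q * q') < q'' * (p * q' + p' * q) \<Longrightarrow>
      token_action.dn G (shift_space G) (shift_act G) (cyl1 G) q p \<inter>
      token_action.dn G (shift_space G) (shift_act G) (cyl2 G - cyl1 G) q' p' \<inter>
      token_action.up G (shift_space G) (shift_act G) (cyl1 G \<union> cyl2 G) q'' p'' \<subseteq> R"
    and R3: "\<And>g p q p' q'. g \<in> carrier G \<Longrightarrow> p * q' < p' * q \<Longrightarrow>
      token_action.up G (shift_space G) (shift_act G) (shift_act G g ` cyl1 G) q p \<inter>
      token_action.dn G (shift_space G) (shift_act G) (cyl1 G) q' p' \<subseteq> R"
    and R4: "token_action.dn G (shift_space G) (shift_act G) (cyl1 G) 1 2 \<subseteq> R"
    and R5: "(\<Inter>n. token_action.up G (shift_space G) (shift_act G) (cyl1 G) n 1) \<inter>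
      meas_action.saturation G (shift_space G) (shift_act G) (cyl1 G) \<subseteq> R"
    and nR: "\<And>A B. A \<in> opens \<union> range K \<Longrightarrow> B \<in> opens \<union> range K \<Longrightarrow> itinerary G \<phi> A B x \<notin> R"
  shows "\<exists>\<mu>. invariant_prob_measure G X \<phi> \<mu>"
proof -
  have act: "meas_action G X \<phi>" ..
  have shact: "meas_action G (shift_space G) (shift_act G)"
    by (rule meas_action_shift[OF is_group countable_carrier])
  interpret X: token_action G X \<phi> by (rule token_actionI[OF act])
  interpret S: token_action G "shift_space G" "shift_act G" by (rule token_actionI[OF shact])
  let ?C = "opens \<union> range K"
  have Cs: "A \<in> sets X" "A \<subseteq> space X" if "A \<in> ?C" for A
  proof -
    show "A \<in> sets X" using that openin_sets[OF openin_opens] closedin_sets[OF compactin_imp_closedin[OF Hausdorff compact_K]] by auto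
    then show "A \<subseteq> space X" by (rule sets.sets_into_space)
  qed
  have cyl: "cyl1 G \<subseteq> space (shift_space G)" "cyl2 G \<subseteq> space (shift_space G)" by (auto simp: cyl1_def cyl2_def)
  have pull: "x \<in> X.up (itinerary G \<phi> A B -` E \<inter> space X) q p \<longleftrightarrow> itinerary G \<phi> A B x \<in> S.up E q p"
    "x \<in> X.dn (itinerary G \<phi> A B -` E \<inter> space X) q p \<longleftrightarrow> itinerary G \<phi> A B x \<in> S.dn E q p"
    if "E \<subseteq> space (shift_space G)" for A B E q p
    using up_dn_pullback[OF act shact, of "itinerary G \<phi> A B" E x q p] itinerary_space itinerary_act that x by auto
  have pre: "itinerary G \<phi> A B -` cyl1 G \<inter> space X = A"
    "itinerary G \<phi> A B -` cyl2 G \<inter> space X = B"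
    "itinerary G \<phi> A B -` (cyl1 G \<union> cyl2 G) \<inter> space X = A \<union> B"
    "itinerary G \<phi> A B -` (cyl2 G - cyl1 G) \<inter> space X = B - A"
    if "A \<in> ?C" "B \<in> ?C" for A B
    using itinerary_cyl[of _ A B] Cs(2)[OF that(1)] Cs(2)[OF that(2)] by (auto simp: subset_iff)
  have pre_g: "itinerary G \<phi> A A -` (shift_act G g ` cyl1 G) \<inter> space X = \<phi> g ` A"
    if A: "A \<in> ?C" and g: "g \<in> carrier G" for A g
  proof -
    have "itinerary G \<phi> A A y \<in> shift_act G g ` cyl1 G \<longleftrightarrow> \<phi> (inv g) y \<in> A" if y: "y \<in> space X" for y
      using itinerary_act[OF inv_closed[OF g] y, of A A] itinerary_cyl(1)[of "\<phi> (inv g) y" A A]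
        itinerary_space[of A A y] y g unfolding S.act_image_eq[OF g cyl(1)] by simp
    then show ?thesis unfolding act_image_eq[OF g Cs(2)[OF A]] by auto
  qed
  \<comment> \<open>\<open>R1\<close> to \<open>R5\<close> speak of cylinders; along the itinerary
    of the pair \<open>A\<close>, \<open>B\<close> they become statements about \<open>A\<close> and
    \<open>B\<close> at \<open>x\<close>.\<close>
  have up_iff: "x \<in> X.up A q p \<longleftrightarrow> itinerary G \<phi> A B x \<in> S.up (cyl1 G) q p"
    "x \<in> X.dn A q p \<longleftrightarrow> itinerary G \<phi> A B x \<in> S.dn (cyl1 G) q p"
    "x \<in> X.up B q p \<longleftrightarrow> itinerary G \<phi> A B x \<in> S.up (cyl2 G) q p"
    "x \<in> X.up (A \<union> B) q p \<longleftrightarrow> itinerary G \<phi> A B x \<in> S.up (cyl1 G \<union> cyl2 G) q p"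
    "x \<in> X.dn (A \<union> B) q p \<longleftrightarrow> itinerary G \<phi> A B x \<in> S.dn (cyl1 G \<union> cyl2 G) q p"
    "x \<in> X.dn (B - A) q p \<longleftrightarrow> itinerary G \<phi> A B x \<in> S.dn (cyl2 G - cyl1 G) q p"
    if "A \<in> ?C" "B \<in> ?C" for A B q p
    using pull[of "cyl1 G" A B q p] pull[of "cyl2 G" A B q p] pull[of "cyl1 G \<union> cyl2 G" A B q p]
      pull[of "cyl2 G - cyl1 G" A B q p] cyl unfolding pre[OF that] by blast+
  have subadd: "\<not> (x \<in> X.up A q p \<and> x \<in> X.up B q' p' \<and> x \<in> X.dn (A \<union> B) q'' p'')"
    if "A \<in> ?C" "B \<in> ?C" "q'' * (p * q' + p' * q) < p'' * (q * q')" for A B p q p' q' p'' q''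
    using R1[OF that(3)] nR[OF that(1,2)] unfolding up_iff[OF that(1,2)] by blast
  have superadd: "\<not> (x \<in> X.dn A q p \<and> x \<in> X.dn (B - A) q' p' \<and> x \<in> X.up (A \<union> B) q'' p'')"
    if "A \<in> ?C" "B \<in> ?C" "p'' * (q * q') < q'' * (p * q' + p' * q)" for A B p q p' q' p'' q''
    using R2[OF that(3)] nR[OF that(1,2)] unfolding up_iff[OF that(1,2)] by blast
  have image: "\<not> (x \<in> X.up (\<phi> g ` A) q p \<and> x \<in> X.dn A q' p')"
    if "A \<in> ?C" "g \<in> carrier G" "p * q' < p' * q" for A g p q p' q'
  proof -
    have "shift_act G g ` cyl1 G \<subseteq> space (shift_space G)" using cyl that(2) by auto
    then have "x \<in> X.up (\<phi> g ` A) q p \<longleftrightarrow> itinerary G \<phi> A A x \<in> S.up (shift_act G g ` cyl1 G) q p"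
      using pull(1)[of "shift_act G g ` cyl1 G" A A q p] unfolding pre_g[OF that(1,2)] by blast
    then show ?thesis using R3[OF that(2,3)] nR[OF that(1,1)] up_iff(2)[OF that(1,1)] by blast
  qed
  have dn12: "x \<notin> X.dn A 1 2" if "A \<in> ?C" for A
    using R4 nR[OF that that] up_iff(2)[OF that that] by blast
  have small: "\<exists>n. x \<notin> X.up A n 1" if A: "A \<in> ?C" and xA: "x \<in> A" for A
  proof (rule ccontr)
    assume "\<nexists>n. x \<notin> X.up A n 1"
    then have "itinerary G \<phi> A A x \<in> (\<Inter>n. S.up (cyl1 G) n 1)" using up_iff(1)[OF A A] by blast
    moreover have "itinerary G \<phi> A A x \<in> S.saturation (cyl1 G)"
      using S.subset_saturation[OF cyl(1)] itinerary_cyl(1)[OF x, of A A] xA by blast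
    ultimately show False using R5 nR[OF A A] by blast
  qed
  interpret cut: rational_cut "\<lambda>A q p. x \<in> X.up A q p" "\<lambda>A q p. x \<in> X.dn A q p" ?C
  proof
    show tot: "x \<in> X.up A q p \<or> x \<in> X.dn A q p" if "A \<in> ?C" for A q p
      using X.up_Un_dn[OF Cs(1)[OF that], of q p] x by blast
    show "x \<in> X.dn A q 0" if "A \<in> ?C" for A q using X.dn_zero[OF Cs(1)[OF that]] x by simp
    show "x \<in> X.up A 1 2" if "A \<in> ?C" for A using tot[OF that] dn12[OF that] by blast
  qed
  define m where "m = cut.cut"
  have m_mono: "m U \<le> m V" if UV: "U \<in> opens" "V \<in> opens" "U \<subseteq> V" for U V
  proof (rule ccontr)
    assume "\<not> m U \<le> m V"
    then obtain r where r: "m V < r" "r < m U" using dense by (metis not_le)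
    obtain p q where pq: "0 < q" "x \<in> X.up V q p" "real p / real q < r"
      using cut.ex_up[of V r] UV r unfolding m_def by auto
    obtain p' q' where pq': "0 < q'" "x \<in> X.dn U q' p'" "r < real p' / real q'"
      using cut.ex_dn[of U r] UV r unfolding m_def by auto
    \<comment> \<open>Superadditivity for \<open>U\<close> and \<open>V - U\<close>, where
      \<open>V - U\<close> gets the trivial lower bound 0/1.\<close>
    have "p * (q' * 1) < q * (p' * 1 + 0 * q')"
      using frac_less_iff[of q q' p p'] pq pq' by (simp add: mult.commute)
    moreover have "x \<in> X.dn (V - U) 1 0" using X.dn_zero[of "V - U"] Cs UV x by simp
    moreover have "U \<union> V = V" using UV(3) by blast
    ultimately show False using superadd[of U V p q' 1 q p' 0] UV pq pq' by auto
  qed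
  have "open_content T opens m 2"
  proof
    show "openin T U" if "U \<in> opens" for U by (rule openin_opens[OF that])
    show "\<exists>U\<in>opens. C \<subseteq> U \<and> U \<subseteq> V" if "compactin T C" "openin T V" "C \<subseteq> V" for C V
      by (rule opens_separate[OF that])
    show "U \<union> V \<in> opens" if "U \<in> opens" "V \<in> opens" for U V by (rule opens_Un[OF that])
    show "0 \<le> m U" "m U \<le> 2" if "U \<in> opens" for U
      using cut.cut_nonneg[of U] cut.cut_le_2[of U] that by (simp_all add: m_def)
    show "m (U \<union> V) \<le> m U + m V" if UV: "U \<in> opens" "V \<in> opens" for U V
    proof (rule ccontr)
      assume neg: "\<not> ?thesis"
      \<comment> \<open>A third of the gap, since each of the three rational approximations may cost
        \<open>d\<close>.\<close>
      define d where "d = (m (U \<union> V) - (m U + m V)) / 3"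
      have d: "0 < d" using neg by (simp add: d_def)
      have d3: "3 * d = m (U \<union> V) - (m U + m V)" by (simp add: d_def)
      obtain p q where 1: "0 < q" "x \<in> X.up U q p" "real p / real q < m U + d"
        using cut.ex_up[of U "m U + d"] UV d unfolding m_def by auto
      obtain p' q' where 2: "0 < q'" "x \<in> X.up V q' p'" "real p' / real q' < m V + d"
        using cut.ex_up[of V "m V + d"] UV d unfolding m_def by auto
      obtain p'' q'' where 3: "0 < q''" "x \<in> X.dn (U \<union> V) q'' p''" "m (U \<union> V) - d < real p'' / real q''"
        using cut.ex_dn[of "U \<union> V" "m (U \<union> V) - d"] opens_Un[OF UV] d unfolding m_def by auto
      have "real p / real q + real p' / real q' < real p'' / real q''"
        using 1(3) 2(3) 3(3) d3 by linarith
      then have "q'' * (p * q' + p' * q) < p'' * (q * q')" using frac_add_less_iff(1) 1(1) 2(1) 3(1) by blast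
      then show False using subadd[of U V] UV 1(2) 2(2) 3(2) by blast
    qed
    show "m U + m V \<le> m (U \<union> V)" if UV: "U \<in> opens" "V \<in> opens" "U \<inter> V = {}" for U V
    proof (rule ccontr)
      assume neg: "\<not> ?thesis"
      define d where "d = ((m U + m V) - m (U \<union> V)) / 3"
      have d: "0 < d" using neg by (simp add: d_def)
      have d3: "3 * d = (m U + m V) - m (U \<union> V)" by (simp add: d_def)
      obtain p q where 1: "0 < q" "x \<in> X.dn U q p" "m U - d < real p / real q"
        using cut.ex_dn[of U "m U - d"] UV d unfolding m_def by auto
      obtain p' q' where 2: "0 < q'" "x \<in> X.dn V q' p'" "m V - d < real p' / real q'"
        using cut.ex_dn[of V "m V - d"] UV d unfolding m_def by auto
      obtain p'' q'' where 3: "0 < q''" "x \<in> X.up (U \<union> V) q'' p''" "real p'' / real q'' < m (U \<union> V) + d"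
        using cut.ex_up[of "U \<union> V" "m (U \<union> V) + d"] opens_Un[OF UV(1,2)] d unfolding m_def by auto
      have "real p'' / real q'' < real p / real q + real p' / real q'"
        using 1(3) 2(3) 3(3) d3 by linarith
      then have "p'' * (q * q') < q'' * (p * q' + p' * q)" using frac_add_less_iff(2) 1(1) 2(1) 3(1) by blast
      moreover have "V - U = V" using UV by blast
      ultimately show False using superadd[of U V] UV 1(2) 2(2) 3(2) by (metis UnI1)
    qed
  qed (use Hausdorff m_mono in auto)
  then interpret open_content T opens m 2 .
  have m_image: "m (\<phi> g ` U) \<le> m U" if g: "g \<in> carrier G" and U: "U \<in> opens" for g U
  proof (rule ccontr)
    assume "\<not> ?thesis"
    then obtain r where r: "m U < r" "r < m (\<phi> g ` U)" using dense by (metis not_le)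
    have gU: "\<phi> g ` U \<in> opens" by (rule opens_act[OF g U])
    \<comment> \<open>The fact \<open>image\<close> says that translating does not decrease the
      value; the reverse is its instance for the translate of \<open>U\<close> and
      \<open>inv g\<close>.\<close>
    have UU: "\<phi> (inv g) ` \<phi> g ` U = U" using act_inv_image[OF _ g] Cs(2) U by blast
    obtain p q where pq: "0 < q" "x \<in> X.up U q p" "real p / real q < r"
      using cut.ex_up[of U r] U r unfolding m_def by auto
    obtain p' q' where pq': "0 < q'" "x \<in> X.dn (\<phi> g ` U) q' p'" "r < real p' / real q'"
      using cut.ex_dn[of "\<phi> g ` U" r] gU r unfolding m_def by auto
    have "p * q' < p' * q" using frac_less_iff pq pq' by (metis order_less_trans)
    then show False using image[of "\<phi> g ` U" "inv g"] gU g UU pq(2) pq'(2) by auto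
  qed
  \<comment> \<open>The point lies in some compact \<open>K l\<close>, so \<open>small\<close>
    excludes that arbitrarily many copies of \<open>K l\<close> fit; this gives the lower bound that
    prevents escape of mass.\<close>
  obtain l where l: "x \<in> K l" using x UN_K topspace_eq by blast
  obtain n where "x \<notin> X.up (K l) n 1" using small[OF _ l] by blast
  then have n: "x \<in> X.dn (K l) n 1" using cut.total[of "K l" n 1] by blast
  \<comment> \<open>\<open>Suc n\<close> rather than \<open>n\<close> keeps the denominator positive
    without a case distinction. The bound passes from \<open>K l\<close> to \<open>U\<close> as in
    \<open>m_mono\<close>.\<close>
  have m_K: "1 / real (Suc n) \<le> m U" if U: "U \<in> opens" "K l \<subseteq> U" for U
  proof (rule ccontr)
    assume "\<not> ?thesis"
    then obtain p q where pq: "0 < q" "x \<in> X.up U q p" "real p / real q < 1 / real (Suc n)"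
      using cut.ex_up[of U "1 / real (Suc n)"] U unfolding m_def by auto
    have "p * Suc n < 1 * q" using frac_less_iff[of q "Suc n" p 1] pq by simp
    then have "p * (n * 1) < q * (1 * 1 + 0 * n)" by (simp add: algebra_simps)
    moreover have "x \<in> X.dn (U - K l) 1 0" using X.dn_zero[of "U - K l"] Cs U x by simp
    moreover have "K l \<union> U = U" using U(2) by blast
    ultimately show False using superadd[of "K l" U p n 1 q 1 0] U pq n by auto
  qed
  have "\<exists>\<mu>. sets \<mu> = sets (borel_of T) \<and> prob_space \<mu> \<and>
    (\<forall>g\<in>carrier G. \<forall>A\<in>sets (borel_of T). emeasure \<mu> (\<phi> g ` A) = emeasure \<mu> A)"
  proof (rule invariant_measure_exists[where K = "K l" and e = "1 / real (Suc n)"])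
    show "\<exists>h\<in>carrier G. \<forall>x\<in>topspace T. \<phi> h (\<phi> g x) = x \<and> \<phi> g (\<phi> h x) = x" if "g \<in> carrier G" for g
      using that act_inv topspace_eq by (intro bexI[of _ "inv g"]) auto
  qed (use cont opens_act m_image compact_K m_K in auto)
  then show ?thesis by (auto simp: invariant_prob_measure_def borel)
qed

text \<open>Contrapositive use of \<open>invariant_measure_of_nonwandering\<close>: every point has
  a pair of sets from \<open>opens \<union> range K\<close> whose itinerary at that point lies in
  \<open>R\<close>.\<close>

theorem generator_exists:
  assumes no_measure: "\<nexists>\<mu>. invariant_prob_measure G X \<phi> \<mu>" and k: "8 \<le> k"
  shows "\<exists>P. generator G X \<phi> k P"
proof -
  have act: "meas_action G X \<phi>" ..
  have shact: "meas_action G (shift_space G) (shift_act G)"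
    by (rule meas_action_shift[OF is_group countable_carrier])
  interpret S: token_action G "shift_space G" "shift_act G" by (rule token_actionI[OF shact])
  obtain R where R: "S.invariant R" "S.traveling R"
    "\<And>p q p' q' p'' q''. q'' * (p * q' + p' * q) < p'' * (q * q') \<Longrightarrow>
      S.up (cyl1 G) q p \<inter> S.up (cyl2 G) q' p' \<inter> S.dn (cyl1 G \<union> cyl2 G) q'' p'' \<subseteq> R"
    "\<And>p q p' q' p'' q''. p'' * (q * q') < q'' * (p * q' + p' * q) \<Longrightarrow>
      S.dn (cyl1 G) q p \<inter> S.dn (cyl2 G - cyl1 G) q' p' \<inter> S.up (cyl1 G \<union> cyl2 G) q'' p'' \<subseteq> R"
    "\<And>g p q p' q'. g \<in> carrier G \<Longrightarrow> p * q' < p' * q \<Longrightarrow>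
      S.up (shift_act G g ` cyl1 G) q p \<inter> S.dn (cyl1 G) q' p' \<subseteq> R"
    "S.dn (cyl1 G) 1 2 \<subseteq> R" "(\<Inter>n. S.up (cyl1 G) n 1) \<inter> S.saturation (cyl1 G) \<subseteq> R"
    using S.wandering_set_exists[OF cyl_sets[OF is_group]] by blast
  let ?C = "opens \<union> range K"
  have cover: "\<exists>A\<in>?C. \<exists>B\<in>?C. itinerary G \<phi> A B x \<in> R" if "x \<in> space X" for x
    using invariant_measure_of_nonwandering[OF that R(3-7)] no_measure by blast
  have Cs: "A \<in> sets X" if "A \<in> ?C" for A
    using that openin_sets[OF openin_opens] closedin_sets[OF compactin_imp_closedin[OF Hausdorff compact_K]] by auto
  define E where "E = from_nat_into (?C \<times> ?C)"
  have CC: "countable (?C \<times> ?C)" "?C \<times> ?C \<noteq> {}" using countable_opens by auto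
  define A B where "A n = fst (E n)" and "B n = snd (E n)" for n
  have AB: "A n \<in> ?C" "B n \<in> ?C" for n
    using from_nat_into[OF CC(2), of n] by (auto simp: A_def B_def E_def mem_Times_iff)
  have ABs: "A n \<in> sets X" "B n \<in> sets X" for n using AB Cs by auto
  define Y where "Y n = {x \<in> space X. itinerary G \<phi> (A n) (B n) x \<in> R}" for n
  have Y: "invariant (Y n)" for n unfolding invariant_def
  proof (intro conjI ballI)
    have "Y n = itinerary G \<phi> (A n) (B n) -` R \<inter> space X" by (auto simp: Y_def)
    then show "Y n \<in> sets X" using measurable_sets[OF itinerary_measurable[OF ABs]] R(1) by simp
    show "\<phi> g x \<in> Y n" if "g \<in> carrier G" "x \<in> Y n" for g x
      using that R(1) by (auto simp: Y_def itinerary_act S.invariant_def)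
  qed
  have UN_Y: "(\<Union>n. Y n) = space X"
  proof (intro equalityI subsetI)
    fix x assume x: "x \<in> space X"
    then obtain C D where CD: "(C, D) \<in> ?C \<times> ?C" "itinerary G \<phi> C D x \<in> R" using cover by blast
    obtain n where "E n = (C, D)" using from_nat_into_surj[OF CC(1) CD(1)] by (auto simp: E_def)
    then show "x \<in> (\<Union>n. Y n)" using CD x by (auto simp: Y_def A_def B_def intro!: exI[of _ n])
  qed (auto simp: Y_def)
  define D where "D = disjointed Y"
  have D: "invariant (D n)" "D n \<subseteq> Y n" for n
    using invariant_disjointed[of Y, OF Y] disjointed_subset[of Y n] by (auto simp: D_def)
  have UN_D: "(\<Union>n. D n) = space X" using UN_disjointed_eq[of Y] UN_Y by (simp add: D_def)
  have D_unique: "i = j" if "y \<in> D i" "y \<in> D j" for y i j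
    using disjoint_family_disjointed[of Y] that by (auto simp: D_def disjoint_family_on_def)
  \<comment> \<open>The \<open>D n\<close> are invariant, so the itinerary of a point of
    \<open>D n\<close> for the glued sets is the one for \<open>A n\<close> and
    \<open>B n\<close>.\<close>
  define A' B' where "A' = (\<Union>n. A n \<inter> D n)" and "B' = (\<Union>n. B n \<inter> D n)"
  have AB's: "A' \<in> sets X" "B' \<in> sets X" unfolding A'_def B'_def using ABs D(1) by (auto intro!: sets.countable_UN sets.Int)
  have R_it: "itinerary G \<phi> A' B' x \<in> R" if x: "x \<in> space X" for x
  proof -
    obtain n where n: "x \<in> D n" using x UN_D by blast
    have "\<phi> g x \<in> D n" if "g \<in> carrier G" for g using D(1)[of n] n that by (simp add: invariant_def)
    then have "\<phi> g x \<in> A' \<longleftrightarrow> \<phi> g x \<in> A n" "\<phi> g x \<in> B' \<longleftrightarrow> \<phi> g x \<in> B n" if "g \<in> carrier G" for g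
      using that D_unique unfolding A'_def B'_def by blast+
    then have "itinerary G \<phi> A' B' x = itinerary G \<phi> (A n) (B n) x" by (auto simp: itinerary_def fun_eq_iff)
    then show ?thesis using n D(2) by (auto simp: Y_def)
  qed
  \<comment> \<open>Inserting the empty set guarantees a nonempty set to enumerate and leaves the
    generated sigma-algebra unchanged.\<close>
  define U where "U = from_nat_into (insert {} \<B>)"
  have "range U = insert {} \<B>" unfolding U_def using countable_\<B> by (intro range_from_nat_into) auto
  moreover have "sigma_sets (space X) (insert {} \<B>) = sigma_sets (space X) \<B>"
    by (intro sigma_sets_eqI) (auto intro: sigma_sets.Empty sigma_sets.Basic)
  ultimately have "sets X = sigma_sets (space X) (range U)" using base_generates by simp
  then show ?thesis
    using generator_of_traveling_itinerary[OF act AB's R(2) R_it _ k] by blast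
qed

end

text \<open>For a discrete group, joint measurability and continuity give those of each single
  translation by fixing the group element. The eight pieces are padded with empty ones up to
  32.\<close>

theorem theorem5p7:
  fixes G :: "('g, 'b) monoid_scheme" and X :: "'a measure" and \<phi> :: "'g \<Rightarrow> 'a \<Rightarrow> 'a"
  assumes "group G" and "countable (carrier G)" and "infinite (carrier G)"
    and "borel_G_space G X \<phi>"
    and "admits_sigma_compact_realization G X \<phi>"
    and "\<nexists>\<mu>. invariant_prob_measure G X \<phi> \<mu>"
  shows "\<exists>A. generator G X \<phi> 32 A"
proof -
  interpret group G by fact
  interpret group_action G "space X" \<phi> using assms(4) by (simp add: borel_G_space_def)
  have prod: "(\<lambda>(g, x). \<phi> g x) \<in> measurable (count_space (carrier G) \<Otimes>\<^sub>M X) X"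
    using assms(4) by (simp add: borel_G_space_def)
  obtain T where T: "Hausdorff_space T" "second_countable T" "sigma_compact_space T"
    "continuous_map (prod_topology (discrete_topology (carrier G)) T) T (\<lambda>(g, x). \<phi> g x)"
    "sets (borel_of T) = sets X"
    using assms(5) unfolding admits_sigma_compact_realization_def by blast
  obtain K where K: "\<And>n::nat. compactin T (K n)" "(\<Union>n. K n) = topspace T"
    using T(3) unfolding sigma_compact_space_def by blast
  obtain \<B> where "countable \<B> \<and> (\<forall>V\<in>\<B>. openin T V) \<and>
      (\<forall>U x. openin T U \<and> x \<in> U \<longrightarrow> (\<exists>V\<in>\<B>. x \<in> V \<and> V \<subseteq> U))"
    using T(2) unfolding second_countable_def by (elim exE)
  then have \<B>: "countable \<B>" "\<And>V. V \<in> \<B> \<Longrightarrow> openin T V"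
    "\<And>U x. openin T U \<Longrightarrow> x \<in> U \<Longrightarrow> \<exists>V\<in>\<B>. x \<in> V \<and> V \<subseteq> U"
    by simp_all
  have "sigma_compact_action G X \<phi> T \<B> K"
  proof (intro sigma_compact_action.intro meas_action.intro meas_action_axioms.intro sigma_compact_action_axioms.intro)
    show "\<phi> g \<in> measurable X X" if "g \<in> carrier G" for g
    proof -
      have "(\<lambda>x. (g, x)) \<in> measurable X (count_space (carrier G) \<Otimes>\<^sub>M X)" using that by simp
      from measurable_compose[OF this prod] show ?thesis by simp
    qed
    show "\<phi> \<one>\<^bsub>G\<^esub> x = x" if "x \<in> space X" for x
      using id_eq_one that by (metis restrict_apply')
    show "\<phi> (g \<otimes>\<^bsub>G\<^esub> h) x = \<phi> g (\<phi> h x)" if "g \<in> carrier G" "h \<in> carrier G" "x \<in> space X" for g h x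
      using composition_rule[OF that(3,1,2)] .
    show "continuous_map T T (\<phi> g)" if "g \<in> carrier G" for g
    proof -
      have "continuous_map T (prod_topology (discrete_topology (carrier G)) T) (\<lambda>x. (g, x))"
        using that by (intro continuous_map_pairedI) auto
      from continuous_map_compose[OF this T(4)] show ?thesis by (simp add: o_def)
    qed
  qed (use assms T K \<B> in auto)
  then show ?thesis using assms(6) by (intro sigma_compact_action.generator_exists) auto
qed

end
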